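(* Let $\sigma>0$, $T>0$ and $M,L,\Xi\in\mathbb{N}$. Let $Y$ be a symmetric real random variable with density $\eta\in\mathcal{C}^M(\mathbb{R})$ such that for all $i\in\{0,\dots,M\}$ there exists $\varepsilon>0$ with $|\eta^{(i)}(v)|=o(|v|^{-2(L+\Xi+1+\varepsilon)-i})$ as $|v|\to\infty$. Then for all $f\in\mathcal{C}^{M,L}_{\mathbf{pol}}(\mathbb{R}_+)$, $m\in\{1,\dots,M\}$, $\nu\in\{0,\dots,\Xi\}$ and $t\in[0,T]$, $$\partial_x^m\mathbb{E}[Y^{2\nu}f(X_1(\sqrt tY,x))]=\int_{-\infty}^\infty\int_0^1(u-u^2)^{m-1}f^{(m)}(w(u,x,v))\,\eta^{*,\nu}_m(v)\,du\,dv,$$ where $w(u,x,v)=x+(2u-1)\sigma\sqrt t\,v\sqrt x+\sigma^2tv^2/4$, $\eta^{*,\nu}_m(v)=(-1)^{m-1}\sum_{j=1}^mc_{j,m}v^j\hat\eta_\nu^{(j)}(v)$ with $\hat\eta_\nu(v)=v^{2\nu}\eta(v)$, and the coefficients $c_{j,m}$ are defined by induction from $c_{1,1}=-1$ through $$c_{l,m}=\Big(\frac{2l}{m-1}-4\Big)c_{l,m-1}\mathbf{1}_{l<m}+\frac{2}{m-1}c_{l-1,m-1}\mathbf{1}_{l>1},\qquad l\in\{1,\dots,m\},\ m\in\{2,\dots,M\}.$$ Suppose now moreover that $\eta^*_m:=\eta^{*,0}_m$ satisfies $\eta^*_m(v)\ge0$ for all $v\in\mathbb{R}$ and all $m\in\{1,\dots,M\}$.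 Then there exists $C\in\mathbb{R}_+$ such that for all $f\in\mathcal{C}^{M,L}_{\mathbf{pol}}(\mathbb{R}_+)$, $$\forall m\in\{1,\dots,M\},\ \forall t\in[0,T],\quad\|\mathbb{E}[f(X_1(\sqrt tY,\cdot))]\|_{m,L}\le(1+Ct)\|f\|_{m,L}.$$ Furthermore, for all $\nu\in\{1,\dots,\Xi\}$, there exists $C\in\mathbb{R}_+$ such that for all $f\in\mathcal{C}^{M,L}_{\mathbf{pol}}(\mathbb{R}_+)$, $$\forall m\in\{1,\dots,M\},\ \forall t\in[0,T],\quad\|\mathbb{E}[Y^{2\nu}f(X_1(\sqrt tY,\cdot))]\|_{m,L}\le C\|f\|_{m,L}.$$
   Context: $\mathbb{R}_+=[0,\infty)$. $X_1(t,x)=(\sqrt x+t\sigma/2)^2$ for $t\in\mathbb{R}$, $x\ge0$. For $m,L\in\mathbb{N}$, $\mathcal{C}^{m,L}_{\mathbf{pol}}(\mathbb{R}_+)$ is the space of $\mathcal{C}^m$ functions $f:\mathbb{R}_+\to\mathbb{R}$ with $\|f\|_{m,L}:=\max_{0\le j\le m}\sup_{x\ge0}\frac{|f^{(j)}(x)|}{1+x^L}<\infty$. $\mathbb{E}[f(X_1(\sqrt tY,\cdot))]$ denotes the function $x\mapsto\mathbb{E}[f(X_1(\sqrt tY,x))]$. *)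

theory Defs
  imports "HOL-Probability.Probability" "HOL-Library.Landau_Symbols"
begin

text \<open>
  Derivatives are taken within the set \<open>S\<close>, so that for \<open>S = {0..}\<close> the derivative at the
  boundary point \<open>0\<close> is the one-sided one. A function on \<open>S\<close> is represented by a total function
  whose values outside \<open>S\<close> are irrelevant: for \<open>S = {0..}\<close> and \<open>x \<in> S\<close>, \<open>nderiv S k f x\<close>
  depends only on the restriction of \<open>f\<close> to \<open>S\<close>.
\<close>

primrec nderiv :: "real set \<Rightarrow> nat \<Rightarrow> (real \<Rightarrow> real) \<Rightarrow> real \<Rightarrow> real" where
  "nderiv S 0 f = f"
| "nderiv S (Suc k) f = (\<lambda>x. vector_derivative (nderiv S k f) (at x within S))"

definition ntimes_differentiable_on :: "nat \<Rightarrow> (real \<Rightarrow> real) \<Rightarrow> real set \<Rightarrow> bool" where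
  "ntimes_differentiable_on m f S \<longleftrightarrow> (\<forall>k<m. nderiv S k f differentiable_on S)"

definition C_on :: "nat \<Rightarrow> (real \<Rightarrow> real) \<Rightarrow> real set \<Rightarrow> bool" where
  "C_on m f S \<longleftrightarrow> ntimes_differentiable_on m f S \<and> continuous_on S (nderiv S m f)"

text \<open>
  The norm takes values in \<open>ennreal\<close>, so that an infinite supremum really is \<open>\<infinity>\<close> and a bound on
  the norm is never satisfied by the unspecified value of \<open>Sup\<close> on an unbounded set of reals.
\<close>

definition pol_norm :: "nat \<Rightarrow> nat \<Rightarrow> (real \<Rightarrow> real) \<Rightarrow> ennreal" where
  "pol_norm m L f =
    Max ((\<lambda>j. SUP x\<in>{0..}. ennreal (\<bar>nderiv {0..} j f x\<bar> / (1 + x ^ L))) ` {0..m})"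

definition C_pol :: "nat \<Rightarrow> nat \<Rightarrow> (real \<Rightarrow> real) set" where
  "C_pol m L = {f. C_on m f {0..} \<and> pol_norm m L f < \<infinity>}"

definition X1 :: "real \<Rightarrow> real \<Rightarrow> real \<Rightarrow> real" where
  "X1 \<sigma> t x = (sqrt x + t * \<sigma> / 2)\<^sup>2"

definition mean_X1 ::
    "'a measure \<Rightarrow> ('a \<Rightarrow> real) \<Rightarrow> real \<Rightarrow> nat \<Rightarrow> real \<Rightarrow> (real \<Rightarrow> real) \<Rightarrow> real \<Rightarrow> real" where
  "mean_X1 P Y \<sigma> \<nu> t f x = (\<integral>\<omega>. Y \<omega> ^ (2 * \<nu>) * f (X1 \<sigma> (sqrt t * Y \<omega>) x) \<partial>P)"

definition symmetric_rv :: "'a measure \<Rightarrow> ('a \<Rightarrow> real) \<Rightarrow> bool" where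
  "symmetric_rv P Y \<longleftrightarrow> distr P borel Y = distr P borel (\<lambda>\<omega>. - Y \<omega>)"

text \<open>
  The first argument of \<open>c_coeff\<close> is the lower index \<open>l\<close>, the second is \<open>m\<close>. Only
  \<open>1 \<le> l \<le> m\<close> is meaningful; the recursion yields \<open>0\<close> for all other arguments. In the last
  equation the informal \<open>m\<close> is \<open>Suc (Suc k)\<close>, so \<open>m - 1 = Suc k\<close>.
\<close>

fun c_coeff :: "nat \<Rightarrow> nat \<Rightarrow> real" where
  "c_coeff l 0 = 0"
| "c_coeff l (Suc 0) = (if l = 1 then - 1 else 0)"
| "c_coeff l (Suc (Suc k)) =
    (if l < Suc (Suc k) then (2 * real l / real (Suc k) - 4) * c_coeff l (Suc k) else 0)
    + (if l > 1 then 2 / real (Suc k) * c_coeff (l - 1) (Suc k) else 0)"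

definition eta_hat :: "(real \<Rightarrow> real) \<Rightarrow> nat \<Rightarrow> real \<Rightarrow> real" where
  "eta_hat \<eta> \<nu> v = v ^ (2 * \<nu>) * \<eta> v"

definition eta_star :: "(real \<Rightarrow> real) \<Rightarrow> nat \<Rightarrow> nat \<Rightarrow> real \<Rightarrow> real" where
  "eta_star \<eta> \<nu> m v =
    (- 1) ^ (m - 1) * (\<Sum>j = 1..m. c_coeff j m * v ^ j * nderiv UNIV j (eta_hat \<eta> \<nu>) v)"

definition w_arg :: "real \<Rightarrow> real \<Rightarrow> real \<Rightarrow> real \<Rightarrow> real \<Rightarrow> real" where
  "w_arg \<sigma> t u x v = x + (2 * u - 1) * \<sigma> * sqrt t * v * sqrt x + \<sigma>\<^sup>2 * t * v\<^sup>2 / 4"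

end

theory Submission imports Defs begin

text \<open>
  Put \<open>s = \<sigma> \<surd>t / 2\<close>, let \<open>w = x + 2 (2 u - 1) s v \<surd>x + s\<^sup>2 v\<^sup>2\<close>, let \<open>J\<^sub>m(x, v)\<close> be the average of
  \<open>f\<^sup>(\<^sup>m\<^sup>)(w)\<close> over \<open>u \<in> [0, 1]\<close> with weight \<open>(u - u\<^sup>2)\<^sup>m\<^sup>-\<^sup>1\<close>, and let \<open>J\<^sub>0\<close> be the mean of the values of
  \<open>f(w)\<close> at \<open>u = 0\<close> and \<open>u = 1\<close>. By symmetry of \<open>Y\<close> the expectation is \<open>\<integral> J\<^sub>0 \<phi>\<^sub>0 dv\<close> with
  \<open>\<phi>\<^sub>0(v) = v\<^sup>2\<^sup>\<nu> \<eta>(v)\<close>. Integrating by parts in \<open>u\<close> gives, for \<open>x > 0\<close>,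
  \<open>\<partial>\<^sub>x J\<^sub>m = a\<^sub>m J\<^sub>m\<^sub>+\<^sub>1 + b\<^sub>m \<partial>\<^sub>v(v J\<^sub>m\<^sub>+\<^sub>1)\<close> with \<open>a\<^sub>0 = 0\<close>, \<open>b\<^sub>0 = 1\<close>, and \<open>a\<^sub>m = 4\<close>, \<open>b\<^sub>m = 2 / m\<close> for \<open>m \<ge> 1\<close>,
  and an integration by parts in \<open>v\<close> turns \<open>\<partial>\<^sub>x \<integral> J\<^sub>m \<phi>\<^sub>m dv\<close> into \<open>\<integral> J\<^sub>m\<^sub>+\<^sub>1 \<phi>\<^sub>m\<^sub>+\<^sub>1 dv\<close> with
  \<open>\<phi>\<^sub>m\<^sub>+\<^sub>1 = a\<^sub>m \<phi>\<^sub>m - b\<^sub>m v \<phi>\<^sub>m'\<close>, which is the recursion of the coefficients \<open>c\<^sub>l\<^sub>,\<^sub>m\<close>. Only one more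
  derivative of \<open>f\<close> is used in each step. The point \<open>x = 0\<close> is reached by continuity. The factor \<open>s\<close>
  is cancelled on the way; for \<open>s = 0\<close> the claim is the mass identity of the next paragraph.

  For the norm estimates, \<open>w\<close> is the convex combination of \<open>(\<surd>x \<plusminus> s v)\<^sup>2\<close> with weights \<open>u\<close> and
  \<open>1 - u\<close>, so that convexity of \<open>y\<^sup>L\<close> reduces the growth of \<open>J\<^sub>m\<close> to the even part of
  \<open>(\<surd>x + s v)\<^sup>2\<^sup>L\<close>, which is \<open>x\<^sup>L + O(s\<^sup>2)\<close>. The total mass of the weight of \<open>J\<^sub>m\<close> times the
  integral of \<open>\<phi>\<^sub>m\<close> does not depend on \<open>m\<close>, hence is \<open>1\<close> for \<open>\<nu> = 0\<close>.
\<close>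

subsection \<open>Integration on the real line\<close>

text \<open>Only the derivative has to be dominated: the mean value inequality passes the bound
  \<open>g\<close> on to the difference quotients, and dominated convergence then applies along
  every sequence tending to \<open>x0\<close>.\<close>

lemma has_real_derivative_integral:
  fixes F F' :: "real \<Rightarrow> 'b \<Rightarrow> real"
  assumes ab: "x0 \<in> {a<..<b}"
    and int: "\<And>x. x \<in> {a<..<b} \<Longrightarrow> integrable M (F x)"
    and der: "\<And>x v. x \<in> {a<..<b} \<Longrightarrow> ((\<lambda>x. F x v) has_real_derivative F' x v) (at x)"
    and bnd: "\<And>x v. x \<in> {a<..<b} \<Longrightarrow> \<bar>F' x v\<bar> \<le> g v"
    and g: "integrable M g"
    and meas: "F' x0 \<in> borel_measurable M"
  shows "((\<lambda>x. \<integral>v. F x v \<partial>M) has_real_derivative (\<integral>v. F' x0 v \<partial>M)) (at x0)"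
proof -
  have "((\<lambda>x. ((\<integral>v. F x v \<partial>M) - (\<integral>v. F x0 v \<partial>M)) / (x - x0)) \<longlongrightarrow> (\<integral>v. F' x0 v \<partial>M))
      (at x0 within {a<..<b})"
    unfolding tendsto_at_iff_sequentially
  proof (intro allI impI)
    fix X :: "nat \<Rightarrow> real"
    assume X: "\<forall>i. X i \<in> {a<..<b} - {x0}" and lim: "X \<longlonglongrightarrow> x0"
    have meas': "(\<lambda>v. (F (X n) v - F x0 v) / (X n - x0)) \<in> borel_measurable M" for n
      using int[of "X n"] int[OF ab] X by (auto intro!: borel_measurable_divide borel_measurable_diff)
    have "(\<lambda>n. \<integral>v. (F (X n) v - F x0 v) / (X n - x0) \<partial>M) \<longlonglongrightarrow> (\<integral>v. F' x0 v \<partial>M)"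
    proof (rule integral_dominated_convergence[where w = g, OF meas meas' g])
      show "AE v in M. (\<lambda>n. (F (X n) v - F x0 v) / (X n - x0)) \<longlonglongrightarrow> F' x0 v"
      proof (rule AE_I2)
        fix v
        have "((\<lambda>x. (F x v - F x0 v) / (x - x0)) \<longlongrightarrow> F' x0 v) (at x0)"
          using der[OF ab, of v] by (simp add: has_field_derivative_iff)
        then show "(\<lambda>n. (F (X n) v - F x0 v) / (X n - x0)) \<longlonglongrightarrow> F' x0 v"
          unfolding tendsto_at_iff_sequentially using X lim by (auto simp: o_def)
      qed
      show "AE v in M. norm ((F (X n) v - F x0 v) / (X n - x0)) \<le> g v" for n
      proof (rule AE_I2)
        fix v
        have "norm (F (X n) v - F x0 v) \<le> g v * norm (X n - x0)"
        proof (rule field_differentiable_bound[where S = "{a<..<b}" and f = "\<lambda>x. F x v" and f' = "\<lambda>x. F' x v"])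
          show "((\<lambda>x. F x v) has_real_derivative F' z v) (at z within {a<..<b})" if "z \<in> {a<..<b}" for z
            using der[OF that] by (rule has_field_derivative_at_within)
          show "norm (F' z v) \<le> g v" if "z \<in> {a<..<b}" for z
            using bnd[OF that] by simp
          show "X n \<in> {a<..<b}" using X by auto
        qed (use ab in auto)
        moreover have "X n \<noteq> x0" using X by auto
        ultimately show "norm ((F (X n) v - F x0 v) / (X n - x0)) \<le> g v"
          by (simp add: field_simps abs_mult)
      qed
    qed
    moreover have eq: "(\<integral>v. (F (X n) v - F x0 v) / (X n - x0) \<partial>M)
        = ((\<integral>v. F (X n) v \<partial>M) - (\<integral>v. F x0 v \<partial>M)) / (X n - x0)" for n
      using int[of "X n"] int[OF ab] X by (subst integral_divide_zero, subst Bochner_Integration.integral_diff) auto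
    ultimately show "((\<lambda>x. ((\<integral>v. F x v \<partial>M) - (\<integral>v. F x0 v \<partial>M)) / (x - x0)) \<circ> X) \<longlonglongrightarrow> (\<integral>v. F' x0 v \<partial>M)"
      unfolding o_def eq[symmetric] by simp
  qed
  then show ?thesis
    using ab by (simp add: has_field_derivative_iff at_within_open[OF ab])
qed

text \<open>A convergent sequence is bounded, so one dominating function for each interval
  \<open>{0..b}\<close> is enough.\<close>

lemma continuous_on_integral_dominated:
  fixes F :: "real \<Rightarrow> 'b \<Rightarrow> real"
  assumes cont: "\<And>v. continuous_on {0..} (\<lambda>x. F x v)"
    and meas: "\<And>x. x \<ge> 0 \<Longrightarrow> F x \<in> borel_measurable M"
    and dom: "\<And>b. \<exists>g. integrable M g \<and> (\<forall>x\<in>{0..b}. \<forall>v. \<bar>F x v\<bar> \<le> g v)"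
  shows "continuous_on {0..} (\<lambda>x. \<integral>v. F x v \<partial>M)"
  unfolding continuous_on_sequentially
proof (intro allI impI ballI)
  fix X x assume x: "x \<in> {0..}" and X: "(\<forall>n. X n \<in> {0::real..}) \<and> X \<longlonglongrightarrow> x"
  have "Bseq X" using X by (auto intro: convergent_imp_Bseq convergentI)
  then obtain b where b: "\<And>n. norm (X n) \<le> b" unfolding Bseq_def by auto
  obtain g where g: "integrable M g" "\<And>x v. x \<in> {0..b} \<Longrightarrow> \<bar>F x v\<bar> \<le> g v"
    using dom[of b] by blast
  have "(\<lambda>n. \<integral>v. F (X n) v \<partial>M) \<longlonglongrightarrow> (\<integral>v. F x v \<partial>M)"
  proof (rule integral_dominated_convergence[where w = g])
    show "AE v in M. (\<lambda>n. F (X n) v) \<longlonglongrightarrow> F x v"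
      using cont x X unfolding continuous_on_sequentially by (auto simp: o_def)
    show "AE v in M. norm (F (X n) v) \<le> g v" for n
      using g(2)[of "X n"] X b[of n] by auto
  qed (use x X meas g in auto)
  then show "((\<lambda>x. \<integral>v. F x v \<partial>M) \<circ> X) \<longlonglongrightarrow> (\<integral>v. F x v \<partial>M)" by (simp add: o_def)
qed

text \<open>The fundamental theorem with derivatives in the interior only gives G y = G 0 plus the
  integral of \<open>G'\<close>, and the integral of a continuous function is differentiable up to
  the end point. This carries formulas proved for x > 0 to x = 0.\<close>

lemma has_real_derivative_at_0_extend:
  fixes G G' :: "real \<Rightarrow> real"
  assumes G: "continuous_on {0..} G" and G': "continuous_on {0..} G'"
    and der: "\<And>x. x > 0 \<Longrightarrow> (G has_real_derivative G' x) (at x)"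
    and x: "x \<ge> 0"
  shows "(G has_real_derivative G' x) (at x within {0..})"
proof -
  have int: "(G' has_integral (G y - G 0)) {0..y}" if "y \<ge> 0" for y
  proof (rule fundamental_theorem_of_calculus_interior[OF that])
    show "continuous_on {0..y} G" using G by (rule continuous_on_subset) auto
    show "(G has_vector_derivative G' z) (at z)" if "z \<in> {0<..<y}" for z
      using der that by (auto simp: has_real_derivative_iff_has_vector_derivative)
  qed
  \<comment> \<open>The right end lies strictly beyond \<open>x\<close>, so cutting the half-line
    there does not affect the filter at \<open>x\<close>.\<close>
  define b where "b = x + 1"
  have "((\<lambda>u. integral {0..u} G') has_vector_derivative G' x) (at x within {0..b})"
    by (rule integral_has_vector_derivative) (use x b_def in \<open>auto intro: continuous_on_subset[OF G']\<close>)
  then have "((\<lambda>u. G 0 + integral {0..u} G') has_vector_derivative G' x) (at x within {0..b})"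
    by (auto intro!: derivative_eq_intros)
  then have "(G has_vector_derivative G' x) (at x within {0..b})"
  proof (rule has_vector_derivative_transform[rotated 2])
    show "G u = G 0 + integral {0..u} G'" if "u \<in> {0..b}" for u
      using integral_unique[OF int[of u]] that by simp
  qed (use x b_def in auto)
  moreover have "at x within {0..b} = at x within {0..}"
    by (rule at_within_nhd[where S = "{..<x + 1}"]) (use b_def x in auto)
  ultimately show ?thesis by (simp add: has_real_derivative_iff_has_vector_derivative)
qed

text \<open>This is the form in which integration by parts in v is used: \<open>F\<close> is the
  product that is differentiated, and its limits at both ends are the boundary terms.\<close>

lemma integral_derivative_eq_0:
  fixes F F' :: "real \<Rightarrow> real"
  assumes der: "\<And>v. (F has_real_derivative F' v) (at v)" and cont: "continuous_on UNIV F'"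
    and int: "integrable lborel F'" and top: "(F \<longlongrightarrow> 0) at_top" and bot: "(F \<longlongrightarrow> 0) at_bot"
  shows "(\<integral>v. F' v \<partial>lborel) = 0"
proof -
  have "(LBINT v=-\<infinity>..\<infinity>. F' v) = 0 - 0"
  proof (rule interval_integral_FTC_integrable[where F = F])
    show "(F has_vector_derivative F' x) (at x)" for x
      using der by (simp add: has_real_derivative_iff_has_vector_derivative)
    show "isCont F' x" for x using cont by (simp add: continuous_on_eq_continuous_at)
    show "set_integrable lborel (einterval (-\<infinity>) \<infinity>) F'"
      using int by (simp add: set_integrable_def)
    show "((F \<circ> real_of_ereal) \<longlongrightarrow> 0) (at_right (- \<infinity>))"
      using bot by (simp add: ereal_tendsto_simps1 )
    show "((F \<circ> real_of_ereal) \<longlongrightarrow> 0) (at_left \<infinity>)"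
      using top by (simp add: ereal_tendsto_simps1 )
  qed auto
  then show ?thesis
    by (simp add: interval_lebesgue_integral_def set_lebesgue_integral_def)
qed

section \<open>Integrability and power decay on the line\<close>

lemma integrable_one_plus_abs_powr:
  assumes "\<delta> > 0"
  shows "integrable lborel (\<lambda>v::real. (1 + \<bar>v\<bar>) powr - (1 + \<delta>))" (is "integrable _ ?f")
proof -
  define F where "F = (\<lambda>v::real. - ((1 + v) powr - \<delta>) / \<delta>)"
  have "(\<integral>\<^sup>+v. ennreal ((1 + \<bar>v\<bar>) powr - (1 + \<delta>)) * indicator {0..} v \<partial>lborel) = 0 - F 0"
  proof (rule nn_integral_FTC_atLeast)
    show "DERIV F x :> (1 + \<bar>x\<bar>) powr - (1 + \<delta>)" if "0 \<le> x" for x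
    proof -
      have *: "- (1 + \<delta>) = - \<delta> - 1" by simp
      show ?thesis
        unfolding F_def * using that assms by (auto intro!: derivative_eq_intros)
    qed
    have "((\<lambda>v. (1 + v) powr - \<delta>) \<longlongrightarrow> 0) at_top"
      using assms by (intro tendsto_neg_powr filterlim_tendsto_add_at_top[OF tendsto_const] filterlim_ident) auto
    then show "(F \<longlongrightarrow> 0) at_top"
      unfolding F_def using tendsto_mult_right_zero[of _ at_top "- 1 / \<delta>"] by simp
  qed auto
  then have "(\<integral>\<^sup>+v. ennreal (indicator {0..} v * ?f v) \<partial>lborel) < \<infinity>"
    by (simp add: ennreal_mult' ennreal_indicator mult.commute)
  then have 1: "set_integrable lborel {0..} ?f"
    unfolding set_integrable_def by (intro integrableI_bounded) auto
  \<comment> \<open>The substitution of -v for v carries integrability to the left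
    half-line.\<close>
  have "integrable lborel (\<lambda>v. indicat_real {0..} (0 + (-1) * v) *\<^sub>R ?f (0 + (-1) * v))"
    using 1 unfolding set_integrable_def by (rule lborel_integrable_real_affine) simp
  moreover have "indicat_real {0..} (0 + (-1) * v) = indicat_real {..0} v" for v :: real
    by (auto simp: indicator_def)
  ultimately have 2: "set_integrable lborel {..0} ?f"
    unfolding set_integrable_def by (simp add: algebra_simps)
  have "set_integrable lborel ({0..} \<union> {..0}) ?f"
    by (rule set_integrable_Un[OF 1 2]) auto
  moreover have "{0..} \<union> {..0::real} = UNIV" by auto
  ultimately show ?thesis by (simp add: set_integrable_def)
qed

text \<open>Decay strictly faster than order p. The margin \<open>\<delta>\<close> makes order 1
  enough for integrability and order 0 enough for the limit 0; the base 1 + |v| keeps the bound free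
  of a singularity at 0.\<close>

definition decays :: "real \<Rightarrow> (real \<Rightarrow> real) \<Rightarrow> bool" where
  "decays p \<phi> \<longleftrightarrow> (\<exists>C. \<exists>\<delta>>0. \<forall>v. \<bar>\<phi> v\<bar> \<le> C * (1 + \<bar>v\<bar>) powr - (p + \<delta>))"

lemma decays_mono:
  assumes "decays p \<phi>" "\<And>v. \<bar>\<psi> v\<bar> \<le> K * (1 + \<bar>v\<bar>) powr k * \<bar>\<phi> v\<bar>" "q \<le> p - k"
  shows "decays q \<psi>"
proof -
  obtain C \<delta> where C: "\<delta> > 0" "\<And>v. \<bar>\<phi> v\<bar> \<le> C * (1 + \<bar>v\<bar>) powr - (p + \<delta>)"
    using assms(1) unfolding decays_def by blast
  have C0: "C \<ge> 0" using C(2)[of 0] by simp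
  have "\<bar>\<psi> v\<bar> \<le> (\<bar>K\<bar> * C) * (1 + \<bar>v\<bar>) powr - (q + \<delta>)" for v
  proof -
    have "\<bar>\<psi> v\<bar> \<le> \<bar>K\<bar> * (1 + \<bar>v\<bar>) powr k * (C * (1 + \<bar>v\<bar>) powr - (p + \<delta>))"
      by (rule order_trans[OF assms(2)]) (intro mult_mono C, auto)
    also have "\<dots> = (\<bar>K\<bar> * C) * (1 + \<bar>v\<bar>) powr (k - (p + \<delta>))"
      unfolding diff_conv_add_uminus powr_add by (simp add: algebra_simps)
    also have "\<dots> \<le> (\<bar>K\<bar> * C) * (1 + \<bar>v\<bar>) powr - (q + \<delta>)"
      using assms(3) C0 by (intro mult_left_mono powr_mono) auto
    finally show ?thesis .
  qed
  then show ?thesis unfolding decays_def using C(1) by blast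
qed

lemma decays_cmult: "decays p \<phi> \<Longrightarrow> decays p (\<lambda>v. c * \<phi> v)"
  by (rule decays_mono[where K = "\<bar>c\<bar>" and k = 0]) (auto simp: abs_mult)

lemma decays_abs: "decays p \<phi> \<Longrightarrow> decays p (\<lambda>v. \<bar>\<phi> v\<bar>)"
  by (simp add: decays_def)

lemma decays_weaken: "decays p \<phi> \<Longrightarrow> q \<le> p \<Longrightarrow> decays q \<phi>"
  by (rule decays_mono[where K = 1 and k = 0]) auto

lemma decays_add:
  assumes "decays p \<phi>" "decays p \<psi>" shows "decays p (\<lambda>v. \<phi> v + \<psi> v)"
proof -
  obtain C \<delta> where C: "\<delta> > 0" "\<And>v. \<bar>\<phi> v\<bar> \<le> C * (1 + \<bar>v\<bar>) powr - (p + \<delta>)"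
    using assms(1) unfolding decays_def by blast
  obtain D \<epsilon> where D: "\<epsilon> > 0" "\<And>v. \<bar>\<psi> v\<bar> \<le> D * (1 + \<bar>v\<bar>) powr - (p + \<epsilon>)"
    using assms(2) unfolding decays_def by blast
  have C0: "C \<ge> 0" "D \<ge> 0" using C(2)[of 0] D(2)[of 0] by simp_all
  define d where "d = min \<delta> \<epsilon>"
  have "\<bar>\<phi> v + \<psi> v\<bar> \<le> (C + D) * (1 + \<bar>v\<bar>) powr - (p + d)" for v
  proof -
    have "C * (1 + \<bar>v\<bar>) powr - (p + \<delta>) \<le> C * (1 + \<bar>v\<bar>) powr - (p + d)"
         "D * (1 + \<bar>v\<bar>) powr - (p + \<epsilon>) \<le> D * (1 + \<bar>v\<bar>) powr - (p + d)"
      using C0 by (auto intro!: mult_left_mono powr_mono simp: d_def)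
    then show ?thesis using C(2)[of v] D(2)[of v] by (simp only: distrib_right) linarith
  qed
  moreover have "d > 0" using C(1) D(1) by (simp add: d_def)
  ultimately show ?thesis unfolding decays_def by blast
qed

lemma decays_0: "decays p (\<lambda>v. 0)"
  unfolding decays_def by (intro exI[of _ 0] exI[of _ 1]) auto

lemma decays_sum: "(\<And>i. i \<in> A \<Longrightarrow> decays p (\<phi> i)) \<Longrightarrow> decays p (\<lambda>v. \<Sum>i\<in>A. \<phi> i v)"
  by (induction A rule: infinite_finite_induct) (auto intro: decays_0 decays_add)

lemma decays_integrable:
  assumes "decays 1 \<phi>" "\<phi> \<in> borel_measurable borel"
  shows "integrable lborel \<phi>"
proof -
  obtain C \<delta> where C: "\<delta> > 0" "\<And>v. \<bar>\<phi> v\<bar> \<le> C * (1 + \<bar>v\<bar>) powr - (1 + \<delta>)"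
    using assms(1) unfolding decays_def by blast
  show ?thesis
  proof (rule Bochner_Integration.integrable_bound)
    show "integrable lborel (\<lambda>v. C * (1 + \<bar>v\<bar>) powr - (1 + \<delta>))"
      using integrable_one_plus_abs_powr[OF C(1)] by simp
    show "AE v in lborel. norm (\<phi> v) \<le> norm (C * (1 + \<bar>v\<bar>) powr - (1 + \<delta>))"
      using C(2) by (intro AE_I2) (metis abs_ge_self order_trans real_norm_def)
  qed (use assms in simp)
qed

lemma decays_tendsto_0:
  assumes "decays 0 \<phi>"
  shows "(\<phi> \<longlongrightarrow> 0) at_top" "(\<phi> \<longlongrightarrow> 0) at_bot"
proof -
  obtain C \<delta> where C: "\<delta> > 0" "\<And>v. \<bar>\<phi> v\<bar> \<le> C * (1 + \<bar>v\<bar>) powr - (0 + \<delta>)"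
    using assms(1) unfolding decays_def by blast
  have *: "(\<phi> \<longlongrightarrow> 0) F" if "filterlim (\<lambda>v. 1 + \<bar>v\<bar>) at_top F" for F
  proof (rule Lim_null_comparison)
    show "\<forall>\<^sub>F x in F. norm (\<phi> x) \<le> C * (1 + \<bar>x\<bar>) powr - \<delta>" using C(2) by simp
    have "((\<lambda>x. (1 + \<bar>x\<bar>) powr - \<delta>) \<longlongrightarrow> 0) F"
      using C(1) that by (intro tendsto_neg_powr) auto
    then show "((\<lambda>x. C * (1 + \<bar>x\<bar>) powr - \<delta>) \<longlongrightarrow> 0) F" by (rule tendsto_mult_right_zero)
  qed
  show "(\<phi> \<longlongrightarrow> 0) at_top"
    by (intro * filterlim_tendsto_add_at_top[OF tendsto_const] filterlim_abs_real)
  have "filterlim (abs :: real \<Rightarrow> real) at_top at_bot"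
    by (simp add: filterlim_at_bot_mirror filterlim_abs_real)
  then show "(\<phi> \<longlongrightarrow> 0) at_bot"
    by (intro * filterlim_tendsto_add_at_top[OF tendsto_const])
qed

subsection \<open>Averages over the unit interval\<close>

text \<open>For positive index m this is integration against an unnormalised symmetric Beta density
  with parameter m. The normalised Beta law tends to equal point masses at 0 and 1 as the parameter
  tends to 0, which is the case of index 0.\<close>

primrec umean :: "nat \<Rightarrow> (real \<Rightarrow> real) \<Rightarrow> real" where
  "umean 0 g = (g 0 + g 1) / 2"
| "umean (Suc k) g = integral {0..1} (\<lambda>u. (u - u\<^sup>2) ^ k * g u)"

lemma umean_integrable:
  "continuous_on {0..1} g \<Longrightarrow> (\<lambda>u. (u - u\<^sup>2) ^ k * g u) integrable_on {0..1::real}"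
  by (intro integrable_continuous_real continuous_intros)

lemma umean_add:
  assumes "continuous_on {0..1} g" "continuous_on {0..1} h"
  shows "umean m (\<lambda>u. g u + h u) = umean m g + umean m h"
proof (cases m)
  case (Suc k)
  then show ?thesis
    using Henstock_Kurzweil_Integration.integral_add[OF umean_integrable[OF assms(1), of k] umean_integrable[OF assms(2), of k]]
    by (simp add: distrib_left)
qed (simp add: field_simps)

lemma umean_cmult: "umean m (\<lambda>u. c * g u) = c * umean m g"
proof (cases m)
  case (Suc k)
  have "(\<lambda>u. (u - u\<^sup>2) ^ k * (c * g u)) = (\<lambda>u. c * ((u - u\<^sup>2) ^ k * g u))"
    by (simp add: ac_simps)
  then show ?thesis using Suc by (simp only: umean.simps) simp
qed (simp add: field_simps)

lemma u_minus_square_nonneg: "u \<in> {0..1::real} \<Longrightarrow> 0 \<le> u - u\<^sup>2"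
  by (simp add: power2_eq_square mult_left_le)

lemma umean_mono:
  assumes "continuous_on {0..1} g" "continuous_on {0..1} h" "\<And>u. u \<in> {0..1} \<Longrightarrow> g u \<le> h u"
  shows "umean m g \<le> umean m h"
proof (cases m)
  case (Suc k)
  then show ?thesis using assms u_minus_square_nonneg
    by (auto intro!: integral_le umean_integrable mult_left_mono)
qed (use assms(3)[of 0] assms(3)[of 1] in simp)

lemma umean_abs_le:
  assumes "continuous_on {0..1} g" "continuous_on {0..1} h" "\<And>u. u \<in> {0..1} \<Longrightarrow> \<bar>g u\<bar> \<le> h u"
  shows "\<bar>umean m g\<bar> \<le> umean m h"
proof -
  have "umean m g \<le> umean m h" using assms by (intro umean_mono) (auto simp: abs_le_iff)
  moreover have "umean m (\<lambda>u. (-1) * g u) \<le> umean m h"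
    using assms by (intro umean_mono continuous_intros) (auto simp: abs_le_iff)
  moreover have "umean m (\<lambda>u. (-1) * g u) = (-1) * umean m g" by (rule umean_cmult)
  ultimately show ?thesis by linarith
qed

lemma umean_one_nonneg: "umean m (\<lambda>u. 1) \<ge> 0"
  using umean_mono[of "\<lambda>u. 0" "\<lambda>u. 1" m] umean_cmult[of m 0 "\<lambda>u. 1"] by (auto simp del: umean.simps)

lemma umean_has_real_derivative:
  assumes der: "\<And>x u. x \<in> U \<Longrightarrow> u \<in> {0..1} \<Longrightarrow> ((\<lambda>x. g x u) has_real_derivative g' x u) (at x within U)"
    and cont: "\<And>x. x \<in> U \<Longrightarrow> continuous_on {0..1} (g x)"
    and cont': "continuous_on (U \<times> {0..1}) (\<lambda>(x, u). g' x u)"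
    and U: "x0 \<in> U" "convex U"
  shows "((\<lambda>x. umean m (g x)) has_real_derivative umean m (g' x0)) (at x0 within U)"
proof (cases m)
  case 0
  then show ?thesis using der[OF U(1), of 0] der[OF U(1), of 1]
    by (auto intro!: derivative_eq_intros)
next
  case (Suc k)
  have "((\<lambda>x. integral (cbox 0 1) (\<lambda>u. (u - u\<^sup>2) ^ k * g x u)) has_real_derivative
      integral (cbox 0 1) (\<lambda>u. (u - u\<^sup>2) ^ k * g' x0 u)) (at x0 within U)"
  proof (rule leibniz_rule_field_derivative[OF _ _ _ U])
    show "continuous_on (U \<times> cbox 0 1) (\<lambda>(x, u). (u - u\<^sup>2) ^ k * g' x u)"
      using cont' by (auto simp: case_prod_beta intro!: continuous_intros)
  qed (use der cont in \<open>auto intro!: derivative_eq_intros umean_integrable\<close>)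
  then show ?thesis using Suc by simp
qed

lemma continuous_on_umean:
  assumes "continuous_on (U \<times> {0..1}) (\<lambda>(x, u). g x u)"
  shows "continuous_on U (\<lambda>x. umean m (g x))"
proof (cases m)
  case 0
  have "continuous_on U (\<lambda>x. g x u)" if "u \<in> {0..1}" for u
  proof -
    have "continuous_on U (\<lambda>x. (x, u))" by (intro continuous_intros)
    then have "continuous_on U (\<lambda>x. case (x, u) of (x, u) \<Rightarrow> g x u)"
      by (rule continuous_on_compose2[OF assms]) (use that in auto)
    then show ?thesis by simp
  qed
  then show ?thesis using 0 by (auto intro!: continuous_intros)
next
  case (Suc k)
  have "continuous_on U (\<lambda>x. integral (cbox 0 1) (\<lambda>u. (u - u\<^sup>2) ^ k * g x u))"
    by (rule integral_continuous_on_param) (use assms in \<open>auto simp: case_prod_beta intro!: continuous_intros\<close>)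
  then show ?thesis using Suc by simp
qed

section \<open>The constants that raise the index of the average\<close>

definition acoef :: "nat \<Rightarrow> real" where "acoef m = (if m = 0 then 0 else 4)"
definition bcoef :: "nat \<Rightarrow> real" where "bcoef m = (if m = 0 then 1 else 2 / real m)"

text \<open>Since 1 - (2u - 1)^2 = 4 (u - u^2), the exponent of the weight goes up by one. At index
  0 the factor vanishes at both end points, hence \<open>acoef 0 = 0\<close>.\<close>

lemma umean_one_minus_square:
  "umean m (\<lambda>u. (1 - (2 * u - 1)\<^sup>2) * g u) = acoef m * umean (Suc m) g"
proof (cases m)
  case (Suc k)
  have *: "(u - u\<^sup>2) ^ k * ((1 - (2 * u - 1)\<^sup>2) * g u) = 4 * ((u - u\<^sup>2) ^ Suc k * g u)" for u
    by (simp add: power2_eq_square algebra_simps)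
  show ?thesis unfolding Suc umean.simps * by (simp add: acoef_def)
qed (simp add: acoef_def)

text \<open>Up to a constant, (2u - 1) (u - u^2)^k is the derivative of (u - u^2)^(k + 1), which
  vanishes at 0 and 1, so no boundary terms remain. At index 0 the left side is half of g 1 - g 0,
  and the claim is the fundamental theorem.\<close>

lemma umean_by_parts:
  assumes der: "\<And>u. u \<in> {0..1} \<Longrightarrow> (g has_real_derivative g' u) (at u within {0..1})"
    and cont: "continuous_on {0..1} g'"
  shows "umean m (\<lambda>u. (2 * u - 1) * g u) = bcoef m / 2 * umean (Suc m) g'"
proof (cases m)
  case 0
  have "(g' has_integral (g 1 - g 0)) {0..1}"
    by (rule fundamental_theorem_of_calculus)
      (use der in \<open>auto simp: has_real_derivative_iff_has_vector_derivative\<close>)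
  then show ?thesis using 0 by (simp add: bcoef_def integral_unique)
next
  case (Suc k)
  have contg: "continuous_on {0..1} g" using der by (meson DERIV_continuous_on)
  let ?p = "\<lambda>u::real. (u - u\<^sup>2) ^ Suc k"
  have "((\<lambda>u. ?p u * g' u - real (Suc k) * ((u - u\<^sup>2) ^ k * ((2 * u - 1) * g u)))
      has_integral (?p 1 * g 1 - ?p 0 * g 0)) {0..1}"
  proof (rule fundamental_theorem_of_calculus)
    show "((\<lambda>u. ?p u * g u) has_vector_derivative
        ?p u * g' u - real (Suc k) * ((u - u\<^sup>2) ^ k * ((2 * u - 1) * g u))) (at u within {0..1})"
      if "u \<in> {0..1}" for u
      unfolding has_real_derivative_iff_has_vector_derivative[symmetric]
      by (rule derivative_eq_intros der[OF that] refl)+ (simp add: algebra_simps)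
  qed simp
  then have "integral {0..1} (\<lambda>u. ?p u * g' u - real (Suc k) * ((u - u\<^sup>2) ^ k * ((2 * u - 1) * g u))) = 0"
    by (simp add: integral_unique)
  then have "umean (Suc m) g' - real (Suc k) * umean m (\<lambda>u. (2 * u - 1) * g u) = 0"
    using Suc contg cont
    by (subst (asm) Henstock_Kurzweil_Integration.integral_diff)
       (auto intro!: umean_integrable continuous_intros integrable_continuous_real simp del: power_Suc)
  then show ?thesis using Suc by (simp add: bcoef_def field_simps del: umean.simps)
qed

text \<open>Split 1 = (1 - (2u - 1)^2) + (2u - 1)^2 and treat the second part by parts with g u = 2u
  - 1. The result compares the masses of consecutive weights.\<close>

lemma umean_one_rec: "umean m (\<lambda>u. 1) = (acoef m + bcoef m) * umean (Suc m) (\<lambda>u. 1)"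
proof -
  have "umean m (\<lambda>u. 1) = umean m (\<lambda>u. (1 - (2 * u - 1)\<^sup>2) * 1 + (2 * u - 1) * (2 * u - 1))"
    by (simp add: power2_eq_square)
  also have "\<dots> = umean m (\<lambda>u. (1 - (2 * u - 1)\<^sup>2) * 1) + umean m (\<lambda>u. (2 * u - 1) * (2 * u - 1))"
    by (intro umean_add continuous_intros)
  also have "umean m (\<lambda>u. (1 - (2 * u - 1)\<^sup>2) * 1) = acoef m * umean (Suc m) (\<lambda>u. 1)"
    by (rule umean_one_minus_square)
  also have "umean m (\<lambda>u. (2 * u - 1) * (2 * u - 1)) = bcoef m / 2 * umean (Suc m) (\<lambda>u. 2 * 1)"
    by (rule umean_by_parts) (auto intro!: derivative_eq_intros)
  also have "umean (Suc m) (\<lambda>u. 2 * 1) = 2 * umean (Suc m) (\<lambda>u. 1)" by (rule umean_cmult)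
  finally show ?thesis by (simp add: algebra_simps)
qed

text \<open>The weights are symmetric about 1/2; formally this is integration by parts with a
  constant g.\<close>

lemma umean_two_u_minus_one: "umean m (\<lambda>u. 2 * u - 1) = 0"
proof -
  have "umean m (\<lambda>u. (2 * u - 1) * 1) = bcoef m / 2 * umean (Suc m) (\<lambda>u. 0)"
    by (rule umean_by_parts) (auto intro!: derivative_eq_intros)
  then show ?thesis by simp
qed

subsection \<open>The interpolating points between the two branches\<close>

lemma decays_mult_power:
  assumes "decays p \<phi>" "\<And>v. \<bar>\<psi> v\<bar> \<le> K * (1 + \<bar>v\<bar>) ^ n" "q \<le> p - real n"
  shows "decays q (\<lambda>v. \<psi> v * \<phi> v)"
proof (rule decays_mono[OF assms(1) _ assms(3)])
  show "\<bar>\<psi> v * \<phi> v\<bar> \<le> K * (1 + \<bar>v\<bar>) powr real n * \<bar>\<phi> v\<bar>" for v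
    using assms(2)[of v] by (simp add: abs_mult powr_realpow mult_right_mono)
qed

text \<open>For t \<ge> 0 this is \<open>w_arg\<close> at s = \<sigma> sqrt t / 2, so that a single
  parameter carries \<sigma> and t.\<close>

definition wpt :: "real \<Rightarrow> real \<Rightarrow> real \<Rightarrow> real \<Rightarrow> real" where
  "wpt s u x v = x + 2 * (2 * u - 1) * s * v * sqrt x + s\<^sup>2 * v\<^sup>2"

lemma wpt_convex_comb:
  "x \<ge> 0 \<Longrightarrow> wpt s u x v = u * (sqrt x + s * v)\<^sup>2 + (1 - u) * (sqrt x - s * v)\<^sup>2"
  by (simp add: wpt_def power2_eq_square algebra_simps)

lemma wpt_nonneg: "x \<ge> 0 \<Longrightarrow> u \<in> {0..1} \<Longrightarrow> wpt s u x v \<ge> 0"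
  by (simp add: wpt_convex_comb)

lemma wpt_le:
  assumes "x \<in> {0..b}" "u \<in> {0..1}"
  shows "wpt s u x v \<le> ((sqrt b + \<bar>s\<bar>) * (1 + \<bar>v\<bar>))\<^sup>2"
proof -
  let ?B = "(sqrt b + \<bar>s\<bar>) * (1 + \<bar>v\<bar>)"
  have "sqrt x + \<bar>s * v\<bar> \<le> ?B"
  proof -
    have "sqrt x \<le> sqrt b" using assms by simp
    moreover have "sqrt b * \<bar>v\<bar> \<ge> 0" using assms by simp
    ultimately show ?thesis using abs_ge_zero[of s]
      by (simp only: abs_mult distrib_left distrib_right mult_1_right)
  qed
  moreover have "\<bar>sqrt x + s * v\<bar> \<le> sqrt x + \<bar>s * v\<bar>" "\<bar>sqrt x - s * v\<bar> \<le> sqrt x + \<bar>s * v\<bar>"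
    using abs_triangle_ineq[of "sqrt x" "s * v"] abs_triangle_ineq4[of "sqrt x" "s * v"] assms by simp_all
  ultimately have "(sqrt x + s * v)\<^sup>2 \<le> ?B\<^sup>2" "(sqrt x - s * v)\<^sup>2 \<le> ?B\<^sup>2"
    by (metis abs_ge_zero order_trans power2_abs power_mono)+
  then have "u * (sqrt x + s * v)\<^sup>2 + (1 - u) * (sqrt x - s * v)\<^sup>2 \<le> u * ?B\<^sup>2 + (1 - u) * ?B\<^sup>2"
    using assms by (intro add_mono mult_left_mono) auto
  also have "\<dots> = ?B\<^sup>2" by (simp add: algebra_simps)
  finally show ?thesis using assms by (simp only: wpt_convex_comb atLeastAtMost_iff)
qed

lemma wpt_growth:
  assumes "x \<in> {0..b}" "u \<in> {0..1}"
  shows "1 + wpt s u x v ^ L \<le> (1 + (sqrt b + \<bar>s\<bar>) ^ (2 * L)) * (1 + \<bar>v\<bar>) ^ (2 * L)"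
proof -
  have "wpt s u x v ^ L \<le> (((sqrt b + \<bar>s\<bar>) * (1 + \<bar>v\<bar>))\<^sup>2) ^ L"
    using assms by (intro power_mono wpt_le wpt_nonneg) auto
  also have "\<dots> = (sqrt b + \<bar>s\<bar>) ^ (2 * L) * (1 + \<bar>v\<bar>) ^ (2 * L)"
    by (simp only: power_mult[symmetric] power_mult_distrib)
  finally have "wpt s u x v ^ L \<le> (sqrt b + \<bar>s\<bar>) ^ (2 * L) * (1 + \<bar>v\<bar>) ^ (2 * L)" .
  moreover have "1 \<le> (1 + \<bar>v\<bar>) ^ (2 * L)" by simp
  ultimately show ?thesis unfolding distrib_right by linarith
qed

lemma continuous_on_wpt [continuous_intros]:
  assumes "continuous_on A f" "continuous_on A g" "continuous_on A k"
  shows "continuous_on A (\<lambda>z. wpt s (f z) (g z) (k z))"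
  unfolding wpt_def by (intro continuous_intros assms)

lemma continuous_on_compose_wpt:
  assumes "continuous_on {0..} h" "continuous_on A f" "continuous_on A g" "continuous_on A k"
    "\<And>z. z \<in> A \<Longrightarrow> f z \<in> {0..1}" "\<And>z. z \<in> A \<Longrightarrow> g z \<ge> 0"
  shows "continuous_on A (\<lambda>z. h (wpt s (f z) (g z) (k z)))"
  by (rule continuous_on_compose2[OF assms(1)]) (use assms wpt_nonneg in \<open>auto intro!: continuous_intros\<close>)

section \<open>Averages of a function along the interpolating points\<close>

definition Jm :: "nat \<Rightarrow> (real \<Rightarrow> real) \<Rightarrow> real \<Rightarrow> real \<Rightarrow> real \<Rightarrow> real" where
  "Jm m h s x v = umean m (\<lambda>u. h (wpt s u x v))"

lemma Jm_continuous_x: "continuous_on {0..} h \<Longrightarrow> continuous_on {0..} (\<lambda>x. Jm m h s x v)"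
  unfolding Jm_def
  by (intro continuous_on_umean) (auto simp: case_prod_beta intro!: continuous_on_compose_wpt[of h] continuous_intros)

lemma Jm_continuous_v: "continuous_on {0..} h \<Longrightarrow> x \<ge> 0 \<Longrightarrow> continuous_on UNIV (\<lambda>v. Jm m h s x v)"
  unfolding Jm_def
  by (intro continuous_on_umean) (auto simp: case_prod_beta intro!: continuous_on_compose_wpt[of h] continuous_intros)

text \<open>The multiplier \<open>r\<close> lets one estimate serve \<open>Jm\<close> itself, where
  it is 1, and also its x-derivative and \<open>Qm\<close>, where it contains s v / sqrt x.\<close>

lemma umean_wpt_bound:
  assumes h: "continuous_on {0..} h" "\<And>y. y \<ge> 0 \<Longrightarrow> \<bar>h y\<bar> \<le> N * (1 + y ^ L)"
    and x: "x \<in> {0..b}" and r: "continuous_on {0..1} r" "\<And>u. u \<in> {0..1} \<Longrightarrow> \<bar>r u\<bar> \<le> R"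
  shows "\<bar>umean m (\<lambda>u. r u * h (wpt s u x v))\<bar>
     \<le> R * (umean m (\<lambda>u. 1) * N * (1 + (sqrt b + \<bar>s\<bar>) ^ (2 * L))) * (1 + \<bar>v\<bar>) ^ (2 * L)"
proof -
  let ?W = "(1 + (sqrt b + \<bar>s\<bar>) ^ (2 * L)) * (1 + \<bar>v\<bar>) ^ (2 * L)"
  \<comment> \<open>Evaluate the growth bound at 0; the case L = 0 is separate because 0^0 =
    1.\<close>
  have N: "N \<ge> 0" using order_trans[OF abs_ge_zero h(2)[of 0]] by (cases L) auto
  have "\<bar>umean m (\<lambda>u. r u * h (wpt s u x v))\<bar> \<le> umean m (\<lambda>u. (R * N * ?W) * 1)"
  proof (rule umean_abs_le)
    show "continuous_on {0..1} (\<lambda>u. r u * h (wpt s u x v))"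
      using x r by (intro continuous_on_mult continuous_on_compose_wpt[OF h(1)] continuous_intros) auto
    fix u :: real assume u: "u \<in> {0..1}"
    have "\<bar>h (wpt s u x v)\<bar> \<le> N * (1 + wpt s u x v ^ L)"
      using x u by (intro h wpt_nonneg) auto
    also have "\<dots> \<le> N * ?W"
      using x u N by (intro mult_left_mono wpt_growth)
    finally have "\<bar>r u\<bar> * \<bar>h (wpt s u x v)\<bar> \<le> R * (N * ?W)"
      using r(2)[OF u] by (intro mult_mono) auto
    then show "\<bar>r u * h (wpt s u x v)\<bar> \<le> (R * N * ?W) * 1" by (simp add: abs_mult)
  qed (auto intro!: continuous_intros)
  then show ?thesis unfolding umean_cmult by (simp add: ac_simps)
qed

lemma Jm_bound:
  assumes "continuous_on {0..} h" "\<And>y. y \<ge> 0 \<Longrightarrow> \<bar>h y\<bar> \<le> N * (1 + y ^ L)" "x \<in> {0..b}"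
  shows "\<bar>Jm m h s x v\<bar> \<le> (umean m (\<lambda>u. 1) * N * (1 + (sqrt b + \<bar>s\<bar>) ^ (2 * L))) * (1 + \<bar>v\<bar>) ^ (2 * L)"
  using umean_wpt_bound[OF assms, of "\<lambda>u. 1" 1] by (simp add: Jm_def del: umean.simps)

text \<open>Index 0 with weight \<open>eta_hat\<close> is the expectation itself, by
  \<open>mean_X1_eq_Gm\<close>. The weight is a parameter because each differentiation in x changes
  it along with the index and the function.\<close>

definition Gm :: "nat \<Rightarrow> (real \<Rightarrow> real) \<Rightarrow> (real \<Rightarrow> real) \<Rightarrow> real \<Rightarrow> real \<Rightarrow> real" where
  "Gm m h \<phi> s x = (\<integral>v. Jm m h s x v * \<phi> v \<partial>lborel)"

lemma Jm_measurable: "continuous_on {0..} h \<Longrightarrow> x \<ge> 0 \<Longrightarrow> Jm m h s x \<in> borel_measurable borel"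
  using Jm_continuous_v[of h x m s] by (rule borel_measurable_continuous_onI)

text \<open>Growth of order 2L of \<open>Jm\<close> leaves decay of order 2. Integrability takes
  order 1; the other order is kept for the factor v in the x-derivative.\<close>

lemma Jm_integrable:
  assumes h: "continuous_on {0..} h" "\<And>y. y \<ge> 0 \<Longrightarrow> \<bar>h y\<bar> \<le> N * (1 + y ^ L)" and x: "x \<ge> 0"
    and \<phi>: "decays (2 * real L + 2) \<phi>" "\<phi> \<in> borel_measurable borel"
  shows "integrable lborel (\<lambda>v. Jm m h s x v * \<phi> v)"
proof (rule decays_integrable)
  show "decays 1 (\<lambda>v. Jm m h s x v * \<phi> v)"
    by (rule decays_mult_power[OF \<phi>(1) Jm_bound[OF h, where b = x]]) (use x in auto)
  show "(\<lambda>v. Jm m h s x v * \<phi> v) \<in> borel_measurable borel"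
    using Jm_measurable[OF h(1) x] \<phi>(2) by simp
qed

lemma Gm_continuous:
  assumes h: "continuous_on {0..} h" "\<And>y. y \<ge> 0 \<Longrightarrow> \<bar>h y\<bar> \<le> N * (1 + y ^ L)"
    and \<phi>: "decays (2 * real L + 2) \<phi>" "\<phi> \<in> borel_measurable borel"
  shows "continuous_on {0..} (\<lambda>x. Gm m h \<phi> s x)"
  unfolding Gm_def
proof (rule continuous_on_integral_dominated)
  show "continuous_on {0..} (\<lambda>x. Jm m h s x v * \<phi> v)" for v
    by (intro continuous_intros Jm_continuous_x h)
  show "(\<lambda>v. Jm m h s x v * \<phi> v) \<in> borel_measurable lborel" if "0 \<le> x" for x
    using Jm_measurable[OF h(1) that] \<phi>(2) by simp
  fix b :: real
  define K where "K = umean m (\<lambda>u. 1) * N * (1 + (sqrt b + \<bar>s\<bar>) ^ (2 * L))"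
  show "\<exists>g. integrable lborel g \<and> (\<forall>x\<in>{0..b}. \<forall>v. \<bar>Jm m h s x v * \<phi> v\<bar> \<le> g v)"
  proof (intro exI[of _ "\<lambda>v. K * (1 + \<bar>v\<bar>) ^ (2 * L) * \<bar>\<phi> v\<bar>"] conjI ballI allI)
    have "decays 1 (\<lambda>v. K * (1 + \<bar>v\<bar>) ^ (2 * L) * \<bar>\<phi> v\<bar>)"
      by (rule decays_mult_power[OF decays_abs[OF \<phi>(1)], where K = "\<bar>K\<bar>" and n = "2 * L"])
        (auto simp: abs_mult)
    then show "integrable lborel (\<lambda>v. K * (1 + \<bar>v\<bar>) ^ (2 * L) * \<bar>\<phi> v\<bar>)"
      by (rule decays_integrable) (use \<phi>(2) in simp)
    show "\<bar>Jm m h s x v * \<phi> v\<bar> \<le> K * (1 + \<bar>v\<bar>) ^ (2 * L) * \<bar>\<phi> v\<bar>" if "x \<in> {0..b}" for x v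
      using Jm_bound[OF h that, of m s v] by (simp add: K_def abs_mult mult_right_mono)
  qed
qed

text \<open>At 0 the function h has only a one-sided derivative, and w may reach 0. Taking the
  derivative of h within the image of w, a subset of the half-line, makes the chain rule valid there
  too.\<close>

lemma has_real_derivative_compose_wpt:
  assumes h: "\<And>y. y \<ge> 0 \<Longrightarrow> (h has_real_derivative h' y) (at y within {0..})"
    and w: "(w has_real_derivative w') (at z within S)"
    and nn: "\<And>z. z \<in> S \<Longrightarrow> w z \<ge> 0" and z: "z \<in> S"
  shows "((\<lambda>z. h (w z)) has_real_derivative h' (w z) * w') (at z within S)"
proof -
  have "(h has_real_derivative h' (w z)) (at (w z) within w ` S)"
    by (rule has_field_derivative_subset[OF h]) (use nn z in auto)
  from DERIV_image_chain[OF this w] show ?thesis by (simp add: o_def)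
qed

lemma Jm_derivative_x:
  assumes h: "\<And>y. y \<ge> 0 \<Longrightarrow> (h has_real_derivative h' y) (at y within {0..})"
    and h': "continuous_on {0..} h'" and x: "x > 0"
  shows "((\<lambda>x. Jm m h s x v) has_real_derivative
      umean m (\<lambda>u. (1 + (2 * u - 1) * (s * v / sqrt x)) * h' (wpt s u x v))) (at x)"
proof -
  have hc: "continuous_on {0..} h" using h by (auto intro: DERIV_continuous_on)
  have "((\<lambda>x. Jm m h s x v) has_real_derivative
      umean m (\<lambda>u. (1 + (2 * u - 1) * (s * v / sqrt x)) * h' (wpt s u x v))) (at x within {0<..})"
    unfolding Jm_def
  proof (rule umean_has_real_derivative)
    show "((\<lambda>x. h (wpt s u x v)) has_real_derivative
        (1 + (2 * u - 1) * (s * v / sqrt x)) * h' (wpt s u x v)) (at x within {0<..})"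
      if "x \<in> {0<..}" "u \<in> {0..1}" for x u
    proof -
      have "((\<lambda>x. wpt s u x v) has_real_derivative (1 + (2 * u - 1) * (s * v / sqrt x))) (at x within {0<..})"
        unfolding wpt_def using that
        by (auto intro!: derivative_eq_intros simp: field_simps)
      from has_real_derivative_compose_wpt[OF h this _ that(1)] that(2)
      show ?thesis by (simp add: wpt_nonneg mult.commute)
    qed
    show "continuous_on {0..1} (\<lambda>u. h (wpt s u x v))" if "x \<in> {0<..}" for x
      using that by (intro continuous_on_compose_wpt[OF hc] continuous_intros) auto
    show "continuous_on ({0<..} \<times> {0..1}) (\<lambda>(x, u). (1 + (2 * u - 1) * (s * v / sqrt x)) * h' (wpt s u x v))"
      by (auto simp: case_prod_beta intro!: continuous_intros continuous_on_compose_wpt[OF h'])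
  qed (use x in auto)
  then show ?thesis using x by (simp add: at_within_open[of x "{0<..}"])
qed

text \<open>The part of the x-derivative of J_m that still contains 1 / sqrt x;
  \<open>Jm_derivative_v\<close> identifies it as a derivative in v.\<close>

definition Qm :: "nat \<Rightarrow> (real \<Rightarrow> real) \<Rightarrow> real \<Rightarrow> real \<Rightarrow> real \<Rightarrow> real" where
  "Qm m h' s x v = umean m (\<lambda>u. ((2 * u - 1) * ((2 * u - 1) + s * v / sqrt x)) * h' (wpt s u x v))"

text \<open>Split the summand 1 as (1 - (2u - 1)^2) + (2u - 1)^2: the first part raises the index,
  the second joins the singular term to form \<open>Qm\<close>.\<close>

lemma Jm_derivative_x_eq:
  assumes h': "continuous_on {0..} h'" and x: "x > 0"
  shows "umean m (\<lambda>u. (1 + (2 * u - 1) * (s * v / sqrt x)) * h' (wpt s u x v))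
    = acoef m * Jm (Suc m) h' s x v + Qm m h' s x v"
proof -
  have *: "continuous_on {0..1} (\<lambda>u. h' (wpt s u x v))"
    using x by (intro continuous_on_compose_wpt[OF h'] continuous_intros) auto
  have "umean m (\<lambda>u. (1 + (2 * u - 1) * (s * v / sqrt x)) * h' (wpt s u x v))
    = umean m (\<lambda>u. (1 - (2 * u - 1)\<^sup>2) * h' (wpt s u x v)
       + ((2 * u - 1) * ((2 * u - 1) + s * v / sqrt x)) * h' (wpt s u x v))"
    by (rule arg_cong[where f = "umean m"]) (simp add: power2_eq_square algebra_simps)
  also have "\<dots> = umean m (\<lambda>u. (1 - (2 * u - 1)\<^sup>2) * h' (wpt s u x v)) + Qm m h' s x v"
    unfolding Qm_def by (intro umean_add continuous_intros *)
  finally show ?thesis by (simp only: umean_one_minus_square Jm_def)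
qed

text \<open>The average of (2u - 1) h(w) is computed in two ways. By parts in u it equals 2 s sqrt x
  times b_m v J_(m+1), because the u-derivative of w is 4 s v sqrt x; differentiated in v it gives 2
  s sqrt x times \<open>Qm\<close>. Thus v J_(m+1), built from \<open>h'\<close>, is differentiable
  in v although \<open>h'\<close> is merely continuous.\<close>

lemma Jm_derivative_v:
  assumes h: "\<And>y. y \<ge> 0 \<Longrightarrow> (h has_real_derivative h' y) (at y within {0..})"
    and h': "continuous_on {0..} h'" and x: "x > 0" and s: "s \<noteq> 0"
  shows "((\<lambda>v. bcoef m * v * Jm (Suc m) h' s x v) has_real_derivative Qm m h' s x v) (at v)"
proof -
  have hc: "continuous_on {0..} h" using h by (auto intro: DERIV_continuous_on)
  have dv: "((\<lambda>v. umean m (\<lambda>u. (2 * u - 1) * h (wpt s u x v))) has_real_derivative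
      umean m (\<lambda>u. (2 * u - 1) * (h' (wpt s u x v) * (2 * (2 * u - 1) * s * sqrt x + 2 * s\<^sup>2 * v)))) (at v)"
  proof (rule umean_has_real_derivative)
    show "((\<lambda>v. (2 * u - 1) * h (wpt s u x v)) has_real_derivative
        (2 * u - 1) * (h' (wpt s u x v) * (2 * (2 * u - 1) * s * sqrt x + 2 * s\<^sup>2 * v))) (at v)"
      if "u \<in> {0..1}" for u v
    proof -
      have "((\<lambda>v. wpt s u x v) has_real_derivative 2 * (2 * u - 1) * s * sqrt x + 2 * s\<^sup>2 * v) (at v)"
        unfolding wpt_def by (auto intro!: derivative_eq_intros)
      from has_real_derivative_compose_wpt[OF h this] that x
      show ?thesis by (intro DERIV_cmult) (simp add: wpt_nonneg)
    qed
    show "continuous_on {0..1} (\<lambda>u. (2 * u - 1) * h (wpt s u x v))" for v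
      using x by (intro continuous_intros continuous_on_compose_wpt[OF hc]) auto
    show "continuous_on (UNIV \<times> {0..1})
        (\<lambda>(v, u). (2 * u - 1) * (h' (wpt s u x v) * (2 * (2 * u - 1) * s * sqrt x + 2 * s\<^sup>2 * v)))"
      using x by (auto simp: case_prod_beta intro!: continuous_intros continuous_on_compose_wpt[OF h'])
  qed auto
  \<comment> \<open>The v-derivative of w is 2 s sqrt x ((2u - 1) + s v / sqrt x), so the common
    factor comes out.\<close>
  have "(2 * u - 1) * (h' (wpt s u x v) * (2 * (2 * u - 1) * s * sqrt x + 2 * s\<^sup>2 * v))
      = (2 * s * sqrt x) * (((2 * u - 1) * ((2 * u - 1) + s * v / sqrt x)) * h' (wpt s u x v))" for u
    using x by (simp add: field_simps power2_eq_square)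
  then have Q: "umean m (\<lambda>u. (2 * u - 1) * (h' (wpt s u x v) * (2 * (2 * u - 1) * s * sqrt x + 2 * s\<^sup>2 * v)))
      = (2 * s * sqrt x) * Qm m h' s x v"
    by (simp only: umean_cmult Qm_def)
  have J: "umean m (\<lambda>u. (2 * u - 1) * h (wpt s u x v)) = (2 * s * sqrt x) * (bcoef m * v * Jm (Suc m) h' s x v)" for v
  proof -
    have "umean m (\<lambda>u. (2 * u - 1) * h (wpt s u x v))
        = bcoef m / 2 * umean (Suc m) (\<lambda>u. (4 * s * v * sqrt x) * h' (wpt s u x v))"
    proof (rule umean_by_parts)
      show "((\<lambda>u. h (wpt s u x v)) has_real_derivative (4 * s * v * sqrt x) * h' (wpt s u x v)) (at u within {0..1})"
        if "u \<in> {0..1}" for u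
      proof -
        have "((\<lambda>u. wpt s u x v) has_real_derivative 4 * s * v * sqrt x) (at u within {0..1})"
          unfolding wpt_def by (auto intro!: derivative_eq_intros)
        from has_real_derivative_compose_wpt[OF h this _ that] x
        show ?thesis by (simp add: wpt_nonneg mult.commute)
      qed
      show "continuous_on {0..1} (\<lambda>u. (4 * s * v * sqrt x) * h' (wpt s u x v))"
        using x by (intro continuous_intros continuous_on_compose_wpt[OF h']) auto
    qed
    then show ?thesis unfolding umean_cmult Jm_def by simp
  qed
  have "((\<lambda>v. (2 * s * sqrt x) * (bcoef m * v * Jm (Suc m) h' s x v)) has_real_derivative
      (2 * s * sqrt x) * Qm m h' s x v) (at v)"
    using dv unfolding J Q .
  from DERIV_cmult[OF this, of "1 / (2 * s * sqrt x)"] show ?thesis using s x by simp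
qed

subsection \<open>The derivative of the averaged function\<close>

definition step_weight :: "nat \<Rightarrow> (real \<Rightarrow> real) \<Rightarrow> (real \<Rightarrow> real) \<Rightarrow> real \<Rightarrow> real" where
  "step_weight m \<phi> \<phi>' v = acoef m * \<phi> v - bcoef m * (v * \<phi>' v)"

lemma decays_step_weight:
  assumes "decays p \<phi>" "decays p (\<lambda>v. v * \<phi>' v)"
  shows "decays p (step_weight m \<phi> \<phi>')"
proof -
  have "decays p (\<lambda>v. acoef m * \<phi> v + (- bcoef m) * (v * \<phi>' v))"
    by (intro decays_add decays_cmult assms)
  then show ?thesis by (simp add: step_weight_def[abs_def])
qed

lemma integral_mult_derivative:
  assumes \<phi>: "\<And>v. (\<phi> has_real_derivative \<phi>' v) (at v)" "continuous_on UNIV \<phi>'"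
    and dec: "decays 1 \<phi>" "decays 1 (\<lambda>v. v * \<phi>' v)"
  shows "(\<integral>v. v * \<phi>' v \<partial>lborel) = - (\<integral>v. \<phi> v \<partial>lborel)"
proof -
  have c: "continuous_on UNIV \<phi>" using \<phi>(1) by (meson DERIV_continuous_on has_field_derivative_at_within)
  have m: "\<phi> \<in> borel_measurable borel" "(\<lambda>v. v * \<phi>' v) \<in> borel_measurable borel"
    by (intro borel_measurable_continuous_onI continuous_intros c \<phi>)+
  have i: "integrable lborel \<phi>" "integrable lborel (\<lambda>v. v * \<phi>' v)"
    by (intro decays_integrable dec m)+
  have d0: "decays 0 (\<lambda>v. v * \<phi> v)"
    by (rule decays_mult_power[OF dec(1), where K = 1 and n = 1]) auto
  have "(\<integral>v. \<phi> v + v * \<phi>' v \<partial>lborel) = 0"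
  proof (rule integral_derivative_eq_0[where F = "\<lambda>v. v * \<phi> v"])
    show "((\<lambda>v. v * \<phi> v) has_real_derivative \<phi> v + v * \<phi>' v) (at v)" for v
      by (rule derivative_eq_intros \<phi>(1) refl)+ simp
  qed (use decays_tendsto_0[OF d0] i c \<phi> in \<open>auto intro!: continuous_intros\<close>)
  then show ?thesis using i by simp
qed

text \<open>By parts, the integral of v \<phi>' is minus that of \<phi>, so the new weight has a_m +
  b_m times the old integral; \<open>umean_one_rec\<close> compensates this factor exactly.\<close>

lemma umean_integral_step_weight:
  assumes \<phi>: "\<And>v. (\<phi> has_real_derivative \<phi>' v) (at v)" "continuous_on UNIV \<phi>'"
    and dec: "decays 1 \<phi>" "decays 1 (\<lambda>v. v * \<phi>' v)"
  shows "umean (Suc m) (\<lambda>u. 1) * (\<integral>v. step_weight m \<phi> \<phi>' v \<partial>lborel) = umean m (\<lambda>u. 1) * (\<integral>v. \<phi> v \<partial>lborel)"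
proof -
  have c: "continuous_on UNIV \<phi>" using \<phi>(1) by (meson DERIV_continuous_on has_field_derivative_at_within)
  have m: "\<phi> \<in> borel_measurable borel" "(\<lambda>v. v * \<phi>' v) \<in> borel_measurable borel"
    by (intro borel_measurable_continuous_onI continuous_intros c \<phi>)+
  have i: "integrable lborel \<phi>" "integrable lborel (\<lambda>v. v * \<phi>' v)"
    by (intro decays_integrable dec m)+
  have "(\<integral>v. step_weight m \<phi> \<phi>' v \<partial>lborel) = (acoef m + bcoef m) * (\<integral>v. \<phi> v \<partial>lborel)"
  proof -
    have "(\<integral>v. step_weight m \<phi> \<phi>' v \<partial>lborel) = acoef m * (\<integral>v. \<phi> v \<partial>lborel) - bcoef m * (\<integral>v. v * \<phi>' v \<partial>lborel)"
      unfolding step_weight_def using i by simp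
    then show ?thesis by (simp add: integral_mult_derivative[OF \<phi> dec] algebra_simps)
  qed
  then show ?thesis
    by (subst (2) umean_one_rec) (simp del: umean.simps)
qed

lemma Gm_derivative_pos:
  assumes h: "\<And>y. y \<ge> 0 \<Longrightarrow> (h has_real_derivative h' y) (at y within {0..})"
    and h': "continuous_on {0..} h'"
    and growth: "\<And>y. y \<ge> 0 \<Longrightarrow> \<bar>h y\<bar> \<le> N * (1 + y ^ L)" "\<And>y. y \<ge> 0 \<Longrightarrow> \<bar>h' y\<bar> \<le> N * (1 + y ^ L)"
    and \<phi>: "\<And>v. (\<phi> has_real_derivative \<phi>' v) (at v)" "continuous_on UNIV \<phi>'"
    and dec: "decays (2 * real L + 2) \<phi>" "decays (2 * real L + 2) (\<lambda>v. v * \<phi>' v)"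
    and s: "s \<noteq> 0" and x: "x > 0"
  shows "((\<lambda>x. Gm m h \<phi> s x) has_real_derivative Gm (Suc m) h' (step_weight m \<phi> \<phi>') s x) (at x)"
proof -
  have hc: "continuous_on {0..} h" using h by (auto intro: DERIV_continuous_on)
  have c: "continuous_on UNIV \<phi>" using \<phi>(1) by (meson DERIV_continuous_on has_field_derivative_at_within)
  have m: "\<phi> \<in> borel_measurable borel" "(\<lambda>v. v * \<phi>' v) \<in> borel_measurable borel"
    by (intro borel_measurable_continuous_onI continuous_intros c \<phi>)+
  have N: "N \<ge> 0" using order_trans[OF abs_ge_zero growth(1)[of 0]] by (cases L) auto
  define D where "D = (\<lambda>x v. umean m (\<lambda>u. (1 + (2 * u - 1) * (s * v / sqrt x)) * h' (wpt s u x v)))"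
  define K where "K = (\<lambda>a b. (1 + \<bar>s\<bar> / sqrt a) * (umean m (\<lambda>u. 1) * N * (1 + (sqrt b + \<bar>s\<bar>) ^ (2 * L))))"
  \<comment> \<open>The singular factor 1 / sqrt y is controlled by a lower bound \<open>a\<close>
    for y; the extra |v| costs one order of decay.\<close>
  have ratio: "\<bar>(2 * u - 1) * (s * v / sqrt y)\<bar> \<le> \<bar>s\<bar> * \<bar>v\<bar> / sqrt a" if "u \<in> {0..1}" "a \<le> y" "0 < a" for u v y a :: real
  proof -
    have "\<bar>(2 * u - 1) * (s * v / sqrt y)\<bar> \<le> 1 * (\<bar>s\<bar> * \<bar>v\<bar> / sqrt a)"
      unfolding abs_mult using that
      by (intro mult_mono) (auto simp: abs_mult abs_le_iff intro!: divide_left_mono)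
    then show ?thesis by simp
  qed
  have lin: "(1 + \<bar>s\<bar> * \<bar>v\<bar> / sqrt a) * (C * (1 + \<bar>v\<bar>) ^ (2 * L)) \<le> ((1 + \<bar>s\<bar> / sqrt a) * C) * (1 + \<bar>v\<bar>) ^ (2 * L + 1)"
    if "0 < a" "0 \<le> C" for a C v :: real
  proof -
    have "1 + \<bar>s\<bar> * \<bar>v\<bar> / sqrt a \<le> (1 + \<bar>s\<bar> / sqrt a) * (1 + \<bar>v\<bar>)"
    proof -
      have "0 \<le> \<bar>s\<bar> / sqrt a" using that by simp
      then show ?thesis by (simp add: distrib_left distrib_right)
    qed
    then have "(1 + \<bar>s\<bar> * \<bar>v\<bar> / sqrt a) * (C * (1 + \<bar>v\<bar>) ^ (2 * L))
        \<le> ((1 + \<bar>s\<bar> / sqrt a) * (1 + \<bar>v\<bar>)) * (C * (1 + \<bar>v\<bar>) ^ (2 * L))"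
      using that by (intro mult_right_mono) auto
    then show ?thesis by (simp add: ac_simps)
  qed
  have C0: "0 \<le> umean m (\<lambda>u. 1) * N * (1 + (sqrt b + \<bar>s\<bar>) ^ (2 * L))" for b
    using N umean_one_nonneg by (intro mult_nonneg_nonneg add_nonneg_nonneg) (auto simp: power_mult)
  have Dbound: "\<bar>D y v\<bar> \<le> K a b * (1 + \<bar>v\<bar>) ^ (2 * L + 1)" if "y \<in> {a<..<b}" "0 < a" for a b y v
  proof -
    have "\<bar>D y v\<bar> \<le> (1 + \<bar>s\<bar> * \<bar>v\<bar> / sqrt a) * (umean m (\<lambda>u. 1) * N * (1 + (sqrt b + \<bar>s\<bar>) ^ (2 * L))) * (1 + \<bar>v\<bar>) ^ (2 * L)"
      unfolding D_def
    proof (rule umean_wpt_bound[OF h' growth(2)])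
      show "\<bar>1 + (2 * u - 1) * (s * v / sqrt y)\<bar> \<le> 1 + \<bar>s\<bar> * \<bar>v\<bar> / sqrt a" if "u \<in> {0..1}" for u
      proof -
        have "a \<le> y" using \<open>y \<in> {a<..<b}\<close> by simp
        from ratio[OF that this \<open>0 < a\<close>, of v] abs_triangle_ineq[of 1 "(2 * u - 1) * (s * v / sqrt y)"]
        show ?thesis by linarith
      qed
    qed (use that in \<open>auto intro!: continuous_intros\<close>)
    then show ?thesis using lin[OF that(2) C0, of v b] by (simp add: K_def mult.assoc)
  qed
  have Qbound: "\<bar>Qm m h' s x v\<bar> \<le> K x x * (1 + \<bar>v\<bar>) ^ (2 * L + 1)" for v
  proof -
    have "\<bar>Qm m h' s x v\<bar> \<le> (1 + \<bar>s\<bar> * \<bar>v\<bar> / sqrt x) * (umean m (\<lambda>u. 1) * N * (1 + (sqrt x + \<bar>s\<bar>) ^ (2 * L))) * (1 + \<bar>v\<bar>) ^ (2 * L)"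
      unfolding Qm_def
    proof (rule umean_wpt_bound[OF h' growth(2)])
      show "\<bar>(2 * u - 1) * ((2 * u - 1) + s * v / sqrt x)\<bar> \<le> 1 + \<bar>s\<bar> * \<bar>v\<bar> / sqrt x" if "u \<in> {0..1}" for u
      proof -
        have "\<bar>(2 * u - 1) * ((2 * u - 1) + s * v / sqrt x)\<bar>
          = \<bar>(2 * u - 1)\<^sup>2 + (2 * u - 1) * (s * v / sqrt x)\<bar>" by (simp add: power2_eq_square algebra_simps)
        also have "\<dots> \<le> (2 * u - 1)\<^sup>2 + \<bar>(2 * u - 1) * (s * v / sqrt x)\<bar>"
          by (rule order_trans[OF abs_triangle_ineq]) simp
        also have "(2 * u - 1)\<^sup>2 \<le> 1" using that by (simp add: abs_square_le_1 abs_le_iff)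
        finally show ?thesis using ratio[OF that, of x x v] x by simp
      qed
    qed (use x in \<open>auto intro!: continuous_intros\<close>)
    then show ?thesis using lin[OF x C0, of v x] by (simp add: K_def mult.assoc)
  qed
  have Deq: "D x v = acoef m * Jm (Suc m) h' s x v + Qm m h' s x v" for v
    unfolding D_def by (rule Jm_derivative_x_eq[OF h' x])
  have cQ: "continuous_on UNIV (Qm m h' s x)"
    unfolding Qm_def using x
    by (intro continuous_on_umean) (auto simp: case_prod_beta intro!: continuous_intros continuous_on_compose_wpt[OF h'])
  have cJ: "continuous_on UNIV (Jm (Suc m) h' s x)"
    by (rule Jm_continuous_v) (use h' x in auto)
  have der: "((\<lambda>x. Gm m h \<phi> s x) has_real_derivative (\<integral>v. D x v * \<phi> v \<partial>lborel)) (at x)"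
    unfolding Gm_def
  \<comment> \<open>The interval from x/2 to x + 1 is a neighbourhood of x that is bounded and stays
    away from 0, so one dominating function works on it.\<close>
  proof (rule has_real_derivative_integral[where a = "x / 2" and b = "x + 1" and F' = "\<lambda>x v. D x v * \<phi> v"
        and g = "\<lambda>v. K (x / 2) (x + 1) * (1 + \<bar>v\<bar>) ^ (2 * L + 1) * \<bar>\<phi> v\<bar>"])
    show "integrable lborel (\<lambda>v. Jm m h s y v * \<phi> v)" if "y \<in> {x/2<..<x+1}" for y
      by (rule Jm_integrable[OF hc growth(1) _ dec(1) m(1)]) (use that x in auto)
    show "((\<lambda>x. Jm m h s x v * \<phi> v) has_real_derivative D y v * \<phi> v) (at y)" if "y \<in> {x/2<..<x+1}" for y v
      unfolding D_def by (intro DERIV_cmult_right Jm_derivative_x[OF h h']) (use that x in auto)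
    show "\<bar>D y v * \<phi> v\<bar> \<le> K (x / 2) (x + 1) * (1 + \<bar>v\<bar>) ^ (2 * L + 1) * \<bar>\<phi> v\<bar>" if "y \<in> {x/2<..<x+1}" for y v
      using Dbound[OF that, of v] x by (simp only: abs_mult) (intro mult_right_mono, auto)
    have "decays 1 (\<lambda>v. K (x / 2) (x + 1) * (1 + \<bar>v\<bar>) ^ (2 * L + 1) * \<bar>\<phi> v\<bar>)"
      by (rule decays_mult_power[OF decays_abs[OF dec(1)], where K = "\<bar>K (x / 2) (x + 1)\<bar>" and n = "2 * L + 1"])
        (auto simp: abs_mult)
    then show "integrable lborel (\<lambda>v. K (x / 2) (x + 1) * (1 + \<bar>v\<bar>) ^ (2 * L + 1) * \<bar>\<phi> v\<bar>)"
      by (rule decays_integrable) (use m in simp)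
    show "(\<lambda>v. D x v * \<phi> v) \<in> borel_measurable lborel"
      unfolding Deq using borel_measurable_continuous_onI[OF cJ] borel_measurable_continuous_onI[OF cQ] m by simp
  qed (use x in auto)
  let ?J = "Jm (Suc m) h' s x" and ?Q = "Qm m h' s x"
  \<comment> \<open>By \<open>Jm_derivative_v\<close>, the v-derivative of this product is Q_m
    \<phi> plus b_m J_(m+1) v \<phi>'. Its integral vanishes, which moves the derivative onto the
    weight.\<close>
  define F where "F = (\<lambda>v. bcoef m * v * ?J v * \<phi> v)"
  have i: "integrable lborel (\<lambda>v. ?J v * \<phi> v)" "integrable lborel (\<lambda>v. ?J v * (v * \<phi>' v))"
    by (rule Jm_integrable[OF h' growth(2)]; use x dec m in simp)+
  have iQ: "integrable lborel (\<lambda>v. ?Q v * \<phi> v)"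
  proof (rule decays_integrable)
    show "decays 1 (\<lambda>v. ?Q v * \<phi> v)"
      by (rule decays_mult_power[OF dec(1) Qbound]) auto
  qed (use m borel_measurable_continuous_onI[OF cQ] in simp)
  have "(\<integral>v. ?Q v * \<phi> v + bcoef m * (?J v * (v * \<phi>' v)) \<partial>lborel) = 0"
  proof (rule integral_derivative_eq_0[where F = F])
    show "(F has_real_derivative ?Q v * \<phi> v + bcoef m * (?J v * (v * \<phi>' v))) (at v)" for v
      unfolding F_def
      by (rule DERIV_cong[OF DERIV_mult[OF Jm_derivative_v[OF h h' x s] \<phi>(1)]]) (simp_all add: algebra_simps)
    show "continuous_on UNIV (\<lambda>v. ?Q v * \<phi> v + bcoef m * (?J v * (v * \<phi>' v)))"
      by (intro continuous_intros cQ cJ c \<phi>)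
    show "integrable lborel (\<lambda>v. ?Q v * \<phi> v + bcoef m * (?J v * (v * \<phi>' v)))"
      using i iQ by simp
    have "decays 0 F"
      unfolding F_def
    proof (rule decays_mult_power[OF dec(1), where n = "2 * L + 1"])
      fix v
      define A where "A = umean (Suc m) (\<lambda>u. 1) * N * (1 + (sqrt x + \<bar>s\<bar>) ^ (2 * L))"
      have "\<bar>?J v\<bar> \<le> A * (1 + \<bar>v\<bar>) ^ (2 * L)"
        unfolding A_def by (rule Jm_bound[OF h' growth(2)]) (use x in auto)
      then have "\<bar>bcoef m * v\<bar> * \<bar>?J v\<bar> \<le> (\<bar>bcoef m\<bar> * (1 + \<bar>v\<bar>)) * (A * (1 + \<bar>v\<bar>) ^ (2 * L))"
        by (intro mult_mono) (auto simp: abs_mult intro!: mult_left_mono)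
      then show "\<bar>bcoef m * v * ?J v\<bar> \<le> (\<bar>bcoef m\<bar> * A) * (1 + \<bar>v\<bar>) ^ (2 * L + 1)"
        by (simp add: abs_mult ac_simps)
    qed auto
    then show "(F \<longlongrightarrow> 0) at_top" "(F \<longlongrightarrow> 0) at_bot" by (rule decays_tendsto_0)+
  qed
  then have Q0: "(\<integral>v. ?Q v * \<phi> v \<partial>lborel) = - bcoef m * (\<integral>v. ?J v * (v * \<phi>' v) \<partial>lborel)"
    using i iQ by simp
  have "(\<integral>v. D x v * \<phi> v \<partial>lborel) = (\<integral>v. acoef m * (?J v * \<phi> v) + ?Q v * \<phi> v \<partial>lborel)"
    by (simp add: Deq algebra_simps)
  also have "\<dots> = acoef m * (\<integral>v. ?J v * \<phi> v \<partial>lborel) - bcoef m * (\<integral>v. ?J v * (v * \<phi>' v) \<partial>lborel)"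
    using i iQ Q0 by simp
  also have "\<dots> = (\<integral>v. acoef m * (?J v * \<phi> v) - bcoef m * (?J v * (v * \<phi>' v)) \<partial>lborel)"
    using i by simp
  also have "\<dots> = Gm (Suc m) h' (step_weight m \<phi> \<phi>') s x"
    unfolding Gm_def step_weight_def by (simp add: algebra_simps)
  finally show ?thesis using der by simp
qed

lemma Gm_zero: "Gm m h \<phi> 0 x = h x * (umean m (\<lambda>u. 1) * (\<integral>v. \<phi> v \<partial>lborel))"
proof -
  have "Jm m h 0 x v = h x * umean m (\<lambda>u. 1)" for v
    using umean_cmult[of m "h x" "\<lambda>u. 1"] by (simp add: Jm_def wpt_def del: umean.simps)
  then show ?thesis by (simp add: Gm_def del: umean.simps)
qed

text \<open>The case s = 0 is separate because the factor s was cancelled. There w = x, so both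
  integrals are multiples of h and h', with the same constant by
  \<open>umean_integral_step_weight\<close>.\<close>

lemma Gm_derivative:
  assumes h: "\<And>y. y \<ge> 0 \<Longrightarrow> (h has_real_derivative h' y) (at y within {0..})"
    and h': "continuous_on {0..} h'"
    and growth: "\<And>y. y \<ge> 0 \<Longrightarrow> \<bar>h y\<bar> \<le> N * (1 + y ^ L)" "\<And>y. y \<ge> 0 \<Longrightarrow> \<bar>h' y\<bar> \<le> N * (1 + y ^ L)"
    and \<phi>: "\<And>v. (\<phi> has_real_derivative \<phi>' v) (at v)" "continuous_on UNIV \<phi>'"
    and dec: "decays (2 * real L + 2) \<phi>" "decays (2 * real L + 2) (\<lambda>v. v * \<phi>' v)"
    and x: "x \<ge> 0"
  shows "((\<lambda>x. Gm m h \<phi> s x) has_real_derivative Gm (Suc m) h' (step_weight m \<phi> \<phi>') s x) (at x within {0..})"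
proof (cases "s = 0")
  case True
  have d1: "decays 1 \<phi>" "decays 1 (\<lambda>v. v * \<phi>' v)" using dec by (auto intro: decays_weaken)
  show ?thesis
    unfolding True Gm_zero umean_integral_step_weight[OF \<phi> d1]
    by (intro DERIV_cmult_right h x)
next
  case False
  have hc: "continuous_on {0..} h" using h by (auto intro: DERIV_continuous_on)
  have c: "continuous_on UNIV \<phi>" using \<phi>(1) by (meson DERIV_continuous_on has_field_derivative_at_within)
  have m: "\<phi> \<in> borel_measurable borel" "step_weight m \<phi> \<phi>' \<in> borel_measurable borel"
    unfolding step_weight_def by (intro borel_measurable_continuous_onI continuous_intros c \<phi>)+
  show ?thesis
  proof (rule has_real_derivative_at_0_extend[OF _ _ _ x])
    show "continuous_on {0..} (Gm m h \<phi> s)"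
      by (rule Gm_continuous[OF hc growth(1) dec(1) m(1)])
    show "continuous_on {0..} (Gm (Suc m) h' (step_weight m \<phi> \<phi>') s)"
      by (rule Gm_continuous[OF h' growth(2) decays_step_weight[OF dec] m(2)])
    show "(Gm m h \<phi> s has_real_derivative Gm (Suc m) h' (step_weight m \<phi> \<phi>') s x) (at x)" if "x > 0" for x
      by (rule Gm_derivative_pos[OF h h' growth \<phi> dec False that])
  qed
qed

subsection \<open>The weights\<close>

lemma C_on_has_derivative:
  assumes "C_on M f S" "k < M" "x \<in> S"
  shows "(nderiv S k f has_real_derivative nderiv S (Suc k) f x) (at x within S)"
proof -
  have "nderiv S k f differentiable (at x within S)"
    using assms by (auto simp: C_on_def ntimes_differentiable_on_def differentiable_on_def)
  then show ?thesis
    by (simp add: vector_derivative_works has_real_derivative_iff_has_vector_derivative)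
qed

lemma C_on_continuous:
  assumes "C_on M f S" "k \<le> M"
  shows "continuous_on S (nderiv S k f)"
proof (cases "k = M")
  case False
  then show ?thesis using assms
    by (auto simp: C_on_def ntimes_differentiable_on_def intro!: differentiable_imp_continuous_on)
qed (use assms in \<open>simp add: C_on_def\<close>)

text \<open>Any chain of successive derivatives starting at f consists of the iterated derivatives,
  since derivatives are unique at limit points. All higher derivatives below are identified by
  exhibiting such a chain.\<close>

lemma nderiv_eqI:
  assumes S: "\<And>x. x \<in> S \<Longrightarrow> at x within S \<noteq> bot"
    and 0: "\<And>x. x \<in> S \<Longrightarrow> f x = g 0 x"
    and der: "\<And>k x. k < m \<Longrightarrow> x \<in> S \<Longrightarrow> (g k has_real_derivative g (Suc k) x) (at x within S)"
  shows "k \<le> m \<Longrightarrow> x \<in> S \<Longrightarrow> nderiv S k f x = g k x"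
proof (induction k arbitrary: x)
  case (Suc k)
  have "(g k has_vector_derivative g (Suc k) x) (at x within S)"
    using der[of k x] Suc.prems by (simp add: has_real_derivative_iff_has_vector_derivative)
  then have "(nderiv S k f has_vector_derivative g (Suc k) x) (at x within S)"
    by (rule has_vector_derivative_transform[rotated 2]) (use Suc in auto)
  then show ?case using vector_derivative_within[OF S] Suc.prems by simp
qed (use 0 in simp)

lemma ntimes_differentiable_onI:
  assumes S: "\<And>x. x \<in> S \<Longrightarrow> at x within S \<noteq> bot"
    and 0: "\<And>x. x \<in> S \<Longrightarrow> f x = g 0 x"
    and der: "\<And>k x. k < m \<Longrightarrow> x \<in> S \<Longrightarrow> (g k has_real_derivative g (Suc k) x) (at x within S)"
  shows "ntimes_differentiable_on m f S"
  unfolding ntimes_differentiable_on_def differentiable_on_def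
proof (intro allI impI ballI)
  fix k x assume k: "k < m" "x \<in> S"
  have "(g k has_derivative (*) (g (Suc k) x)) (at x within S)"
    using der[OF k] by (simp add: has_field_derivative_def)
  then have "(nderiv S k f has_derivative (*) (g (Suc k) x)) (at x within S)"
    by (rule has_derivative_transform[rotated 2]) (use k nderiv_eqI[OF S 0 der] in auto)
  then show "nderiv S k f differentiable at x within S" by (auto simp: differentiable_def)
qed

lemma at_within_atLeast_neq_bot: "x \<in> {0..} \<Longrightarrow> at x within {0::real..} \<noteq> bot"
proof -
  assume "x \<in> {0..}"
  then have "at x within {0..x + 1} \<le> at x within {0..}" "at x within {0..x + 1} \<noteq> bot"
    by (auto intro: at_le simp: at_within_Icc_at_right trivial_limit_within islimpt_Icc)
  then show ?thesis by (metis bot.extremum_unique)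
qed

text \<open>In the Leibniz formula only two terms survive. For k = 0 the truncated index k - 1 is
  harmless, its coefficient being 0.\<close>

lemma nderiv_mult_ident:
  assumes g: "C_on M g UNIV"
  shows "C_on M (\<lambda>v. v * g v) UNIV"
    and "k \<le> M \<Longrightarrow> nderiv UNIV k (\<lambda>v. v * g v) v = v * nderiv UNIV k g v + real k * nderiv UNIV (k - 1) g v"
proof -
  define d where "d = (\<lambda>k v. v * nderiv UNIV k g v + real k * nderiv UNIV (k - 1) g v)"
  have der: "(d k has_real_derivative d (Suc k) x) (at x within UNIV)" if "k < M" for k x
  proof -
    note D = C_on_has_derivative[OF g, of _ x, simplified]
    have 1: "((\<lambda>v. v * nderiv UNIV k g v) has_real_derivative
        1 * nderiv UNIV k g x + nderiv UNIV (Suc k) g x * x) (at x)"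
      using D[OF that] by (intro DERIV_mult DERIV_ident) simp
    have 2: "((\<lambda>v. real k * nderiv UNIV (k - 1) g v) has_real_derivative real k * nderiv UNIV k g x) (at x)"
      using D[of "k - 1"] that by (cases k) (auto intro!: DERIV_cmult simp del: of_nat_Suc)
    show ?thesis using DERIV_add[OF 1 2] by (simp add: d_def algebra_simps)
  qed
  have eq: "nderiv UNIV k (\<lambda>v. v * g v) v = d k v" if "k \<le> M" for k v
    by (rule nderiv_eqI[where m = M]) (use der that in \<open>auto simp: d_def\<close>)
  show "k \<le> M \<Longrightarrow> nderiv UNIV k (\<lambda>v. v * g v) v = v * nderiv UNIV k g v + real k * nderiv UNIV (k - 1) g v"
    using eq by (simp add: d_def)
  have "ntimes_differentiable_on M (\<lambda>v. v * g v) UNIV"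
    by (rule ntimes_differentiable_onI[where g = d]) (use der in \<open>auto simp: d_def\<close>)
  moreover have "continuous_on UNIV (nderiv UNIV M (\<lambda>v. v * g v))"
    unfolding eq[OF order_refl] d_def
    by (intro continuous_intros C_on_continuous[OF g]) auto
  ultimately show "C_on M (\<lambda>v. v * g v) UNIV" by (simp add: C_on_def)
qed

text \<open>The products v^j g^(j) are invariant under scaling, so a single order p serves all j.
  This is the shape of the hypothesis on \<eta>, and v d/dv preserves linear combinations of these
  products, raising j by at most one.\<close>

definition euler_decay :: "nat \<Rightarrow> real \<Rightarrow> (real \<Rightarrow> real) \<Rightarrow> bool" where
  "euler_decay M p g \<longleftrightarrow> C_on M g UNIV \<and> (\<forall>j\<le>M. decays p (\<lambda>v. v ^ j * nderiv UNIV j g v))"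

lemma euler_decay_mult_ident:
  assumes "euler_decay M p g" shows "euler_decay M (p - 1) (\<lambda>v. v * g v)"
proof -
  have g: "C_on M g UNIV" "\<And>j. j \<le> M \<Longrightarrow> decays p (\<lambda>v. v ^ j * nderiv UNIV j g v)"
    using assms by (auto simp: euler_decay_def)
  have vE: "decays (p - 1) (\<lambda>v. v * (v ^ j * nderiv UNIV j g v))" if "j \<le> M" for j
    by (rule decays_mult_power[OF g(2)[OF that], where K = 1 and n = 1]) auto
  have "decays (p - 1) (\<lambda>v. v ^ j * nderiv UNIV j (\<lambda>v. v * g v) v)" if "j \<le> M" for j
  proof -
    have "decays (p - 1) (\<lambda>v. v * (v ^ j * nderiv UNIV j g v) + real j * (v * (v ^ (j - 1) * nderiv UNIV (j - 1) g v)))"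
      using that by (intro decays_add decays_cmult vE) auto
    \<comment> \<open>One power of v accompanies the lowered derivative, so the second term is again
      v times a product of the same form.\<close>
    moreover have "v ^ j * nderiv UNIV j (\<lambda>v. v * g v) v
        = v * (v ^ j * nderiv UNIV j g v) + real j * (v * (v ^ (j - 1) * nderiv UNIV (j - 1) g v))" for v
      unfolding nderiv_mult_ident(2)[OF g(1) that] by (cases j) (simp_all add: algebra_simps)
    ultimately show ?thesis by simp
  qed
  then show ?thesis using nderiv_mult_ident(1)[OF g(1)] by (simp add: euler_decay_def)
qed

lemma euler_decay_mult_power:
  assumes "euler_decay M p g" shows "euler_decay M (p - real n) (\<lambda>v. v ^ n * g v)"
proof (induction n)
  case (Suc n)
  show ?case using euler_decay_mult_ident[OF Suc] by (simp add: algebra_simps)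
qed (use assms in simp)

text \<open>Far out, |v| is comparable with 1 + |v|, and the remaining compact interval is handled
  by continuity. The \<epsilon> of the hypothesis becomes the margin 2 \<epsilon> in
  \<open>decays\<close>.\<close>

lemma decays_of_smallo:
  assumes e: "\<epsilon> > 0" and c: "continuous_on UNIV g"
    and o: "(\<lambda>v. \<bar>g v\<bar>) \<in> o[at_infinity](\<lambda>v. \<bar>v\<bar> powr (- 2 * (a + \<epsilon>) - real i))"
  shows "decays (2 * a) (\<lambda>v. v ^ i * g v)"
proof -
  define q where "q = 2 * a + 2 * \<epsilon>"
  have "eventually (\<lambda>v. norm \<bar>g v\<bar> \<le> 1 * norm (\<bar>v\<bar> powr (- 2 * (a + \<epsilon>) - real i))) at_infinity"
    using o by (rule landau_o.smallD) simp
  then obtain B0 where B0: "\<And>v. norm v \<ge> B0 \<Longrightarrow> \<bar>g v\<bar> \<le> \<bar>v\<bar> powr (- 2 * (a + \<epsilon>) - real i)"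
    by (auto simp: eventually_at_infinity)
  define B where "B = max B0 1"
  have far: "\<bar>v ^ i * g v\<bar> \<le> 2 powr \<bar>q\<bar> * (1 + \<bar>v\<bar>) powr - q" if "\<bar>v\<bar> \<ge> B" for v
  proof -
    have v: "\<bar>v\<bar> \<ge> 1" "\<bar>v\<bar> \<ge> B0" using that by (auto simp: B_def)
    have "\<bar>v ^ i * g v\<bar> \<le> \<bar>v\<bar> powr real i * \<bar>v\<bar> powr (- 2 * (a + \<epsilon>) - real i)"
      using v B0[of v] by (simp add: abs_mult power_abs powr_realpow mult_left_mono)
    also have "\<dots> = \<bar>v\<bar> powr - q" by (simp add: powr_add[symmetric] q_def algebra_simps)
    also have "\<dots> \<le> 2 powr \<bar>q\<bar> * (1 + \<bar>v\<bar>) powr - q"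
    \<comment> \<open>The sign of q decides whether 1 + |v| \<le> 2 |v| or |v| \<le> 1 + |v| is
      needed.\<close>
    proof (cases "q \<ge> 0")
      case True
      have "\<bar>v\<bar> powr - q \<le> ((1 + \<bar>v\<bar>) / 2) powr - q"
        using v True by (intro powr_mono2') auto
      also have "\<dots> = 2 powr q * (1 + \<bar>v\<bar>) powr - q"
        by (simp add: powr_divide powr_minus field_simps)
      finally show ?thesis using True by simp
    next
      case False
      have "\<bar>v\<bar> powr - q \<le> (1 + \<bar>v\<bar>) powr - q"
        using False by (intro powr_mono2) auto
      also have "\<dots> \<le> 2 powr \<bar>q\<bar> * (1 + \<bar>v\<bar>) powr - q"
        using mult_right_mono[of 1 "2 powr \<bar>q\<bar>" "(1 + \<bar>v\<bar>) powr - q"] by (simp add: ge_one_powr_ge_zero)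
      finally show ?thesis .
    qed
    finally show ?thesis .
  qed
  have "continuous_on {- B..B} (\<lambda>v. (v ^ i * g v) / (1 + \<bar>v\<bar>) powr - q)"
    by (intro continuous_intros continuous_on_subset[OF c]) auto
  then have "compact ((\<lambda>v. (v ^ i * g v) / (1 + \<bar>v\<bar>) powr - q) ` {- B..B})"
    by (rule compact_continuous_image) simp
  then obtain A where A: "\<And>v. v \<in> {- B..B} \<Longrightarrow> \<bar>(v ^ i * g v) / (1 + \<bar>v\<bar>) powr - q\<bar> \<le> A"
    using compact_imp_bounded[THEN bounded_iff[THEN iffD1]] by fastforce
  define C where "C = max A (2 powr \<bar>q\<bar>)"
  have "\<bar>v ^ i * g v\<bar> \<le> C * (1 + \<bar>v\<bar>) powr - (2 * a + 2 * \<epsilon>)" for v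
  proof (cases "\<bar>v\<bar> \<ge> B")
    case True
    show ?thesis
      by (rule order_trans[OF far[OF True]]) (simp add: C_def q_def mult_right_mono)
  next
    case False
    then have "v \<in> {- B..B}" by auto
    then have "\<bar>v ^ i * g v\<bar> \<le> A * (1 + \<bar>v\<bar>) powr - q"
      using A[of v] by (simp add: field_simps)
    also have "\<dots> \<le> C * (1 + \<bar>v\<bar>) powr - q" by (simp add: C_def mult_right_mono)
    finally show ?thesis by (simp add: q_def)
  qed
  then show ?thesis unfolding decays_def using e by (intro exI[of _ C] exI[of _ "2 * \<epsilon>"]) auto
qed

text \<open>Index 0 is set apart because the formula of \<open>eta_star\<close> gives an empty sum
  there, while the iteration starts from \<open>eta_hat\<close>.\<close>

definition phi :: "(real \<Rightarrow> real) \<Rightarrow> nat \<Rightarrow> nat \<Rightarrow> real \<Rightarrow> real" where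
  "phi \<eta> \<nu> m = (if m = 0 then eta_hat \<eta> \<nu> else eta_star \<eta> \<nu> m)"

lemma euler_decay_phi:
  assumes "euler_decay M p (eta_hat \<eta> \<nu>)" "m \<le> M"
  shows "decays p (phi \<eta> \<nu> m)" "continuous_on UNIV (phi \<eta> \<nu> m)"
proof -
  have g: "C_on M (eta_hat \<eta> \<nu>) UNIV" "\<And>j. j \<le> M \<Longrightarrow> decays p (\<lambda>v. v ^ j * nderiv UNIV j (eta_hat \<eta> \<nu>) v)"
    using assms by (auto simp: euler_decay_def)
  have "decays p (eta_star \<eta> \<nu> m)"
    unfolding eta_star_def[abs_def]
  proof (intro decays_cmult decays_sum)
    fix j assume "j \<in> {1..m}"
    then have "decays p (\<lambda>v. c_coeff j m * (v ^ j * nderiv UNIV j (eta_hat \<eta> \<nu>) v))"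
      using assms(2) by (intro decays_cmult g) auto
    then show "decays p (\<lambda>v. c_coeff j m * v ^ j * nderiv UNIV j (eta_hat \<eta> \<nu>) v)" by (simp add: mult.assoc)
  qed
  then show "decays p (phi \<eta> \<nu> m)" using g(2)[of 0] by (simp add: phi_def)
  have "continuous_on UNIV (eta_star \<eta> \<nu> m)"
    unfolding eta_star_def[abs_def] using assms(2)
    by (intro continuous_intros C_on_continuous[OF g(1)]) auto
  then show "continuous_on UNIV (phi \<eta> \<nu> m)"
    using C_on_continuous[OF g(1), of 0] by (simp add: phi_def)
qed

text \<open>With E_j = v^j H_j one has v E_j' = j E_j + E_(j+1). Hence 4 - (2/m) v d/dv acts on the
  coefficients by multiplying c_l by 4 - 2l/m and passing -2/m times c_l to index l + 1, which up to
  the alternating sign is the recursion of \<open>c_coeff\<close>.\<close>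

lemma euler_decay_phi_step:
  assumes "euler_decay M p (eta_hat \<eta> \<nu>)" "m < M"
  obtains \<phi>' where "\<And>v. (phi \<eta> \<nu> m has_real_derivative \<phi>' v) (at v)" "continuous_on UNIV \<phi>'"
    "decays p (\<lambda>v. v * \<phi>' v)" "phi \<eta> \<nu> (Suc m) = step_weight m (phi \<eta> \<nu> m) \<phi>'"
proof -
  define H where "H = (\<lambda>j. nderiv UNIV j (eta_hat \<eta> \<nu>))"
  define E where "E = (\<lambda>j v. v ^ j * H j v)"
  have C: "C_on M (eta_hat \<eta> \<nu>) UNIV" and dE: "\<And>j. j \<le> M \<Longrightarrow> decays p (E j)"
    using assms by (auto simp: euler_decay_def E_def H_def)
  have dH: "(H j has_real_derivative H (Suc j) v) (at v)" if "j < M" for j v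
    using C_on_has_derivative[OF C that, of v] by (simp add: H_def)
  have cH: "continuous_on UNIV (H j)" if "j \<le> M" for j
    using C_on_continuous[OF C that] by (simp add: H_def)
  show ?thesis
  proof (cases "m = 0")
    case True
    show ?thesis
    proof (rule that[of "H 1"])
      show "(phi \<eta> \<nu> m has_real_derivative H 1 v) (at v)" for v
        using dH[of 0 v] assms(2) True by (simp add: phi_def H_def)
      show "continuous_on UNIV (H 1)" using cH[of 1] assms(2) by simp
      show "decays p (\<lambda>v. v * H 1 v)" using dE[of 1] assms(2) by (simp add: E_def)
      \<comment> \<open>The start c_(1,1) = -1 matches a_0 = 0 and b_0 = 1.\<close>
      show "phi \<eta> \<nu> (Suc m) = step_weight m (phi \<eta> \<nu> m) (H 1)"
        using True by (auto simp: phi_def step_weight_def eta_star_def acoef_def bcoef_def H_def fun_eq_iff)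
    qed
  next
    case False
    then obtain k where k: "m = Suc k" by (cases m) auto
    define \<phi>' where "\<phi>' = (\<lambda>v. (- 1) ^ (m - 1) * (\<Sum>j = 1..m. c_coeff j m * (real j * v ^ (j - 1) * H j v + v ^ j * H (Suc j) v)))"
    have star: "eta_star \<eta> \<nu> m v = (- 1) ^ (m - 1) * (\<Sum>j = 1..m. c_coeff j m * E j v)" for m v
      by (simp add: eta_star_def E_def H_def mult.assoc)
    have vphi: "v * \<phi>' v = (- 1) ^ (m - 1) * (\<Sum>j = 1..m. c_coeff j m * (real j * E j v + E (Suc j) v))" for v
    proof -
      have "v * (c_coeff j m * (real j * v ^ (j - 1) * H j v + v ^ j * H (Suc j) v))
          = c_coeff j m * (real j * E j v + E (Suc j) v)" if "j \<in> {1..m}" for j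
        using that by (cases j) (simp_all add: E_def algebra_simps)
      then have "v * (\<Sum>j = 1..m. c_coeff j m * (real j * v ^ (j - 1) * H j v + v ^ j * H (Suc j) v))
          = (\<Sum>j = 1..m. c_coeff j m * (real j * E j v + E (Suc j) v))"
        unfolding sum_distrib_left by (intro sum.cong) auto
      then show ?thesis by (simp add: \<phi>'_def mult.left_commute)
    qed
    show ?thesis
    proof (rule that[of \<phi>'])
      show "(phi \<eta> \<nu> m has_real_derivative \<phi>' v) (at v)" for v
      proof -
        have "((\<lambda>v. (- 1) ^ (m - 1) * (\<Sum>j = 1..m. c_coeff j m * E j v)) has_real_derivative \<phi>' v) (at v)"
          unfolding \<phi>'_def
        proof (intro DERIV_cmult DERIV_sum)
          fix j assume "j \<in> {1..m}"
          then have "j < M" using assms by auto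
          show "(E j has_real_derivative real j * v ^ (j - 1) * H j v + v ^ j * H (Suc j) v) (at v)"
            unfolding E_def by (rule derivative_eq_intros dH \<open>j < M\<close> refl)+ simp
        qed
        then show ?thesis using False by (simp add: phi_def star[abs_def])
      qed
      show "continuous_on UNIV \<phi>'"
        unfolding \<phi>'_def using assms(2) by (intro continuous_intros cH) auto
      show "decays p (\<lambda>v. v * \<phi>' v)"
        unfolding vphi using assms(2) by (intro decays_cmult decays_sum decays_add dE) auto
      show "phi \<eta> \<nu> (Suc m) = step_weight m (phi \<eta> \<nu> m) \<phi>'"
      proof
        fix v
        let ?c = "\<lambda>j. c_coeff j m"
        have "(\<Sum>l = 1..Suc m. c_coeff l (Suc m) * E l v)
          = (\<Sum>l = 1..Suc m. (if l < Suc m then (2 * real l / real m - 4) * ?c l else 0) * E l v)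
            + (\<Sum>l = 1..Suc m. (if l > 1 then 2 / real m * ?c (l - 1) else 0) * E l v)"
          unfolding k by (simp only: c_coeff.simps distrib_right sum.distrib)
        also have "(\<Sum>l = 1..Suc m. (if l < Suc m then (2 * real l / real m - 4) * ?c l else 0) * E l v)
          = (\<Sum>l = 1..m. (2 * real l / real m - 4) * ?c l * E l v)" by simp
        \<comment> \<open>The term l = 1 is zero; shifting the index by one turns c_(l-1) E_l into
          c_l E_(l+1).\<close>
        also have "(\<Sum>l = 1..Suc m. (if l > 1 then 2 / real m * ?c (l - 1) else 0) * E l v)
          = (\<Sum>l = Suc 1..Suc m. 2 / real m * ?c (l - 1) * E l v)"
          by (subst sum.atLeast_Suc_atMost) (auto intro!: sum.cong)
        also have "\<dots> = (\<Sum>l = 1..m. 2 / real m * ?c l * E (Suc l) v)"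
          by (subst sum.shift_bounds_cl_Suc_ivl) simp
        finally have "(\<Sum>l = 1..Suc m. c_coeff l (Suc m) * E l v)
          = (\<Sum>l = 1..m. (2 * real l / real m - 4) * ?c l * E l v + 2 / real m * ?c l * E (Suc l) v)"
          by (simp only: sum.distrib)
        also have "\<dots> = (\<Sum>l = 1..m. 2 / real m * (?c l * (real l * E l v + E (Suc l) v)) - 4 * (?c l * E l v))"
          by (intro sum.cong) (simp_all add: algebra_simps)
        also have "\<dots> = 2 / real m * (\<Sum>l = 1..m. ?c l * (real l * E l v + E (Suc l) v)) - 4 * (\<Sum>l = 1..m. ?c l * E l v)"
          by (simp only: sum_subtractf sum_distrib_left)
        finally have *: "(\<Sum>l = 1..Suc m. c_coeff l (Suc m) * E l v) = \<dots>" .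
        have "phi \<eta> \<nu> (Suc m) v = (- 1) ^ m * (\<Sum>l = 1..Suc m. c_coeff l (Suc m) * E l v)"
          by (simp add: phi_def star del: sum.cl_ivl_Suc)
        \<comment> \<open>The sign changes from (-1)^(m-1) to (-1)^m, which exchanges the signs of
          the two sums.\<close>
        also have "\<dots> = 4 * eta_star \<eta> \<nu> m v - 2 / real m * (v * \<phi>' v)"
          unfolding * star vphi unfolding k by (simp add: algebra_simps del: sum.cl_ivl_Suc c_coeff.simps)
        also have "\<dots> = step_weight m (phi \<eta> \<nu> m) \<phi>' v"
          using False by (simp add: step_weight_def acoef_def bcoef_def phi_def)
        finally show "phi \<eta> \<nu> (Suc m) v = step_weight m (phi \<eta> \<nu> m) \<phi>' v" .
      qed
    qed
  qed
qed

subsection \<open>Growth estimates and the expectation\<close>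

text \<open>Odd powers of s v cancel in the sum, the constant term is r^(2L), and every other term
  contains s^2. The factor 2^(2L) is the sum of the binomial coefficients.\<close>

lemma even_binomial_le:
  fixes r s v S :: real
  assumes r: "r \<ge> 0" and s: "\<bar>s\<bar> \<le> S"
  shows "((r + s * v) ^ (2 * L) + (r - s * v) ^ (2 * L)) / 2
    \<le> r ^ (2 * L) + s\<^sup>2 * (2 ^ (2 * L) * (1 + S) ^ (2 * L) * (1 + \<bar>v\<bar>) ^ (2 * L) * (1 + r ^ (2 * L)))"
proof -
  define n where "n = 2 * L"
  define X where "X = (1 + S) ^ n * (1 + \<bar>v\<bar>) ^ n * (1 + r ^ n)"
  have S: "S \<ge> 0" using s by linarith
  have X: "X \<ge> 0" using S r by (simp add: X_def)
  \<comment> \<open>The term k = 0 is kept exactly; k = 1 cancels; for k \<ge> 2 a factor s^2 is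
    split off and the rest is bounded by 2 X.\<close>
  have term_le: "real (n choose k) * ((s * v) ^ k + (- (s * v)) ^ k) * r ^ (n - k)
      \<le> (if k = 0 then 2 * r ^ n else 0) + real (n choose k) * (2 * s\<^sup>2 * X)" if k: "k \<le> n" for k
  proof -
    consider "k = 0" | "k = 1" | "k \<ge> 2" by linarith
    then show ?thesis
    proof cases
      case 3
      have "\<bar>s\<bar> ^ (k - 2) \<le> (1 + S) ^ (k - 2)" using s by (intro power_mono) auto
      also have "\<dots> \<le> (1 + S) ^ n" using k S by (intro power_increasing) auto
      finally have 1: "\<bar>s\<bar> ^ (k - 2) \<le> (1 + S) ^ n" .
      have "\<bar>v\<bar> ^ k \<le> (1 + \<bar>v\<bar>) ^ k" by (intro power_mono) auto
      also have "\<dots> \<le> (1 + \<bar>v\<bar>) ^ n" using k by (intro power_increasing) auto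
      finally have 2: "\<bar>v\<bar> ^ k \<le> (1 + \<bar>v\<bar>) ^ n" .
      have 3: "r ^ (n - k) \<le> 1 + r ^ n"
      proof (cases "r \<le> 1")
        case True
        then have "r ^ (n - k) \<le> 1" using r by (intro power_le_one)
        then show ?thesis using r by (simp add: add_increasing2)
      next
        case False
        then have "r ^ (n - k) \<le> r ^ n" by (intro power_increasing) auto
        then show ?thesis by simp
      qed
      have "((s * v) ^ k + (- (s * v)) ^ k) * r ^ (n - k) \<le> 2 * \<bar>s * v\<bar> ^ k * r ^ (n - k)"
      proof (rule mult_right_mono)
        have "(s * v) ^ k \<le> \<bar>s * v\<bar> ^ k" "(- (s * v)) ^ k \<le> \<bar>s * v\<bar> ^ k"
          by (metis abs_ge_self power_abs) (metis abs_ge_self abs_minus_cancel power_abs)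
        then show "(s * v) ^ k + (- (s * v)) ^ k \<le> 2 * \<bar>s * v\<bar> ^ k" by simp
      qed (use r in simp)
      also have "\<dots> = 2 * s\<^sup>2 * (\<bar>s\<bar> ^ (k - 2) * \<bar>v\<bar> ^ k * r ^ (n - k))"
      proof -
        obtain j where "k = 2 + j" using \<open>k \<ge> 2\<close> le_Suc_ex by blast
        then have "\<bar>s\<bar> ^ k = \<bar>s\<bar> ^ 2 * \<bar>s\<bar> ^ (k - 2)" by (simp only: power_add) simp
        then show ?thesis by (simp add: abs_mult power_mult_distrib)
      qed
      also have "\<dots> \<le> 2 * s\<^sup>2 * X"
        unfolding X_def using r S by (intro mult_left_mono mult_mono 1 2 3) auto
      finally have "real (n choose k) * (((s * v) ^ k + (- (s * v)) ^ k) * r ^ (n - k)) \<le> real (n choose k) * (2 * s\<^sup>2 * X)"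
        by (intro mult_left_mono) auto
      then show ?thesis using \<open>k \<ge> 2\<close> by (simp add: mult.assoc)
    qed (use X in auto)
  qed
  have "(r + s * v) ^ n + (r - s * v) ^ n
      = (\<Sum>k\<le>n. real (n choose k) * ((s * v) ^ k + (- (s * v)) ^ k) * r ^ (n - k))"
    using binomial_ring[of "s * v" r n] binomial_ring[of "- (s * v)" r n]
    by (simp add: sum.distrib[symmetric] algebra_simps)
  also have "\<dots> \<le> (\<Sum>k\<le>n. (if k = 0 then 2 * r ^ n else 0) + real (n choose k) * (2 * s\<^sup>2 * X))"
    by (intro sum_mono term_le) simp
  also have "\<dots> = 2 * r ^ n + real (\<Sum>k\<le>n. n choose k) * (2 * s\<^sup>2 * X)"
    by (simp add: sum.distrib sum_distrib_right)
  also have "(\<Sum>k\<le>n. n choose k) = 2 ^ n" by (rule choose_row_sum)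
  finally show ?thesis by (simp add: X_def n_def algebra_simps)
qed

lemma power_convex_comb_le:
  fixes a b :: real
  assumes "a \<ge> 0" "b \<ge> 0" "u \<in> {0..1}"
  shows "(u * a + (1 - u) * b) ^ L \<le> u * a ^ L + (1 - u) * b ^ L"
proof -
  have "convex_on {0..} (\<lambda>x::real. x ^ L)"
    by (cases "even L") (auto intro: convex_on_subset[OF convex_power_even] convex_power_odd)
  then show ?thesis
    using assms convex_onD[of "{0..}" "\<lambda>x. x ^ L" "1 - u" a b] by auto
qed

definition growth_const :: "real \<Rightarrow> nat \<Rightarrow> real" where
  "growth_const S L = 2 ^ (2 * L) * (1 + S) ^ (2 * L)"

text \<open>Unlike in \<open>Jm_bound\<close>, the leading constant at s = 0 is exactly N (1 + x^L)
  times the mass of the average; the correction has order s^2, hence order t. This is what gives a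
  factor 1 + C t.\<close>

lemma Jm_sharp_bound:
  assumes h: "continuous_on {0..} h" "\<And>y. y \<ge> 0 \<Longrightarrow> \<bar>h y\<bar> \<le> N * (1 + y ^ L)"
    and x: "x \<ge> 0" and s: "\<bar>s\<bar> \<le> S"
  shows "\<bar>Jm m h s x v\<bar> \<le> N * (1 + x ^ L) * (umean m (\<lambda>u. 1) * (1 + s\<^sup>2 * growth_const S L * (1 + \<bar>v\<bar>) ^ (2 * L)))"
proof -
  define A where "A = (sqrt x + s * v) ^ (2 * L)"
  define B where "B = (sqrt x - s * v) ^ (2 * L)"
  define g where "g = s\<^sup>2 * growth_const S L * (1 + \<bar>v\<bar>) ^ (2 * L)"
  have N: "N \<ge> 0" using order_trans[OF abs_ge_zero h(2)[of 0]] by (cases L) auto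
  have "\<bar>Jm m h s x v\<bar> \<le> umean m (\<lambda>u. N * (1 + (A + B) / 2) * 1 + N * ((A - B) / 2) * (2 * u - 1))"
    unfolding Jm_def
  proof (rule umean_abs_le)
    show "continuous_on {0..1} (\<lambda>u. h (wpt s u x v))"
      using x by (intro continuous_on_compose_wpt[OF h(1)] continuous_intros) auto
    fix u :: real assume u: "u \<in> {0..1}"
    have "\<bar>h (wpt s u x v)\<bar> \<le> N * (1 + wpt s u x v ^ L)"
      using x u by (intro h wpt_nonneg) auto
    also have "wpt s u x v ^ L \<le> u * A + (1 - u) * B"
      unfolding wpt_convex_comb[OF x] A_def B_def power_mult
      by (intro power_convex_comb_le u) auto
    \<comment> \<open>The affine bound is written as a constant plus a multiple of 2u - 1; the
      latter averages to 0.\<close>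
    also have "N * (1 + (u * A + (1 - u) * B)) = N * (1 + (A + B) / 2) * 1 + N * ((A - B) / 2) * (2 * u - 1)"
      by (simp add: field_simps)
    finally show "\<bar>h (wpt s u x v)\<bar> \<le> N * (1 + (A + B) / 2) * 1 + N * ((A - B) / 2) * (2 * u - 1)"
      using N by (simp add: mult_left_mono)
  qed (intro continuous_intros)
  also have "\<dots> = umean m (\<lambda>u. N * (1 + (A + B) / 2) * 1) + umean m (\<lambda>u. N * ((A - B) / 2) * (2 * u - 1))"
    by (intro umean_add continuous_intros)
  also have "\<dots> = N * (1 + (A + B) / 2) * umean m (\<lambda>u. 1)"
    unfolding umean_cmult umean_two_u_minus_one by simp
  also have "\<dots> \<le> N * ((1 + x ^ L) * (1 + g)) * umean m (\<lambda>u. 1)"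
  proof (intro mult_right_mono mult_left_mono N umean_one_nonneg)
    have r: "sqrt x ^ (2 * L) = x ^ L" using x by (simp add: power_mult)
    have "(A + B) / 2 \<le> x ^ L + g * (1 + x ^ L)"
      using even_binomial_le[of "sqrt x" s S v L] x s
      unfolding r by (simp add: A_def B_def g_def growth_const_def ac_simps)
    then show "1 + (A + B) / 2 \<le> (1 + x ^ L) * (1 + g)" by (simp add: algebra_simps)
  qed
  finally show ?thesis by (simp add: g_def ac_simps)
qed

lemma Gm_bound:
  assumes h: "continuous_on {0..} h" "\<And>y. y \<ge> 0 \<Longrightarrow> \<bar>h y\<bar> \<le> N * (1 + y ^ L)"
    and x: "x \<ge> 0" and s: "\<bar>s\<bar> \<le> S"
    and \<phi>: "decays (2 * real L + 2) \<phi>" "continuous_on UNIV \<phi>"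
  shows "\<bar>Gm m h \<phi> s x\<bar> \<le> N * (1 + x ^ L) * (umean m (\<lambda>u. 1) * (\<integral>v. \<bar>\<phi> v\<bar> \<partial>lborel)
    + s\<^sup>2 * (growth_const S L * umean m (\<lambda>u. 1) * (\<integral>v. (1 + \<bar>v\<bar>) ^ (2 * L) * \<bar>\<phi> v\<bar> \<partial>lborel)))"
proof -
  have \<phi>m: "\<phi> \<in> borel_measurable borel" using \<phi>(2) by (rule borel_measurable_continuous_onI)
  have "decays 1 (\<lambda>v. (1 + \<bar>v\<bar>) ^ (2 * L) * \<bar>\<phi> v\<bar>)"
    by (rule decays_mult_power[OF decays_abs[OF \<phi>(1)], where K = 1 and n = "2 * L"]) auto
  then have i2: "integrable lborel (\<lambda>v. (1 + \<bar>v\<bar>) ^ (2 * L) * \<bar>\<phi> v\<bar>)"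
    by (rule decays_integrable) (use \<phi>m in simp)
  have i1: "integrable lborel (\<lambda>v. \<bar>\<phi> v\<bar>)"
    using \<phi> \<phi>m by (intro integrable_abs decays_integrable) (auto intro: decays_weaken)
  let ?R = "\<lambda>v. N * (1 + x ^ L) * (umean m (\<lambda>u. 1) * \<bar>\<phi> v\<bar>
    + s\<^sup>2 * (growth_const S L * umean m (\<lambda>u. 1) * ((1 + \<bar>v\<bar>) ^ (2 * L) * \<bar>\<phi> v\<bar>)))"
  have "norm (Gm m h \<phi> s x) \<le> (\<integral>v. ?R v \<partial>lborel)"
    unfolding Gm_def
  proof (rule Bochner_Integration.integral_norm_bound_integral)
    show "integrable lborel (\<lambda>v. Jm m h s x v * \<phi> v)"
      by (rule Jm_integrable[OF h x \<phi>(1) \<phi>m])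
    show "integrable lborel ?R" using i1 i2 by simp
    show "norm (Jm m h s x v * \<phi> v) \<le> ?R v" for v
      using mult_right_mono[OF Jm_sharp_bound[OF h x s, of m v], of "\<bar>\<phi> v\<bar>"]
      by (simp add: abs_mult algebra_simps del: umean.simps)
  qed
  also have "(\<integral>v. ?R v \<partial>lborel) = N * (1 + x ^ L) * (umean m (\<lambda>u. 1) * (\<integral>v. \<bar>\<phi> v\<bar> \<partial>lborel)
    + s\<^sup>2 * (growth_const S L * umean m (\<lambda>u. 1) * (\<integral>v. (1 + \<bar>v\<bar>) ^ (2 * L) * \<bar>\<phi> v\<bar> \<partial>lborel)))"
    using i1 i2 by (simp del: umean.simps)
  finally show ?thesis by simp
qed

text \<open>The scheme is the branch u = 1. Replacing Y by -Y gives the branch u = 0 with the same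
  expectation, since v^(2\<nu>) is even, so the expectation is the mean over both branches.\<close>

lemma mean_X1_eq_Gm:
  fixes P :: "'a measure" and Y :: "'a \<Rightarrow> real"
  assumes Y: "distributed P lborel Y (\<lambda>v. ennreal (\<eta> v))" "\<And>v. \<eta> v \<ge> 0" "symmetric_rv P Y"
    and f: "continuous_on {0..} f" "\<And>y. y \<ge> 0 \<Longrightarrow> \<bar>f y\<bar> \<le> N * (1 + y ^ L)"
    and \<phi>: "decays (2 * real L + 2) (eta_hat \<eta> \<nu>)" "continuous_on UNIV (eta_hat \<eta> \<nu>)"
    and x: "x \<ge> 0"
  shows "integrable P (\<lambda>\<omega>. Y \<omega> ^ (2 * \<nu>) * f (X1 \<sigma> (sqrt t * Y \<omega>) x))"
    and "mean_X1 P Y \<sigma> \<nu> t f x = Gm 0 f (eta_hat \<eta> \<nu>) (\<sigma> * sqrt t / 2) x"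
proof -
  define s where "s = \<sigma> * sqrt t / 2"
  define g where "g = (\<lambda>u v. v ^ (2 * \<nu>) * f (wpt s u x v))"
  have X1: "X1 \<sigma> (sqrt t * y) x = wpt s 1 x y" for y
    using x by (simp add: X1_def wpt_convex_comb s_def mult.commute mult.left_commute)
  have fc: "continuous_on UNIV (\<lambda>v. f (wpt s u x v))" if "u \<in> {0..1}" for u
    using x that by (intro continuous_on_compose_wpt[OF f(1)] continuous_intros) auto
  have gm: "g u \<in> borel_measurable borel" if "u \<in> {0..1}" for u
    unfolding g_def by (intro borel_measurable_continuous_onI continuous_intros fc that)
  have N: "N \<ge> 0" using order_trans[OF abs_ge_zero f(2)[of 0]] by (cases L) auto
  have fb: "\<bar>f (wpt s u x v)\<bar> \<le> (N * (1 + (sqrt x + \<bar>s\<bar>) ^ (2 * L))) * (1 + \<bar>v\<bar>) ^ (2 * L)" if "u \<in> {0..1}" for u v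
  proof -
    have "\<bar>f (wpt s u x v)\<bar> \<le> N * (1 + wpt s u x v ^ L)"
      using x that by (intro f wpt_nonneg) auto
    also have "\<dots> \<le> N * ((1 + (sqrt x + \<bar>s\<bar>) ^ (2 * L)) * (1 + \<bar>v\<bar>) ^ (2 * L))"
      using x that N by (intro mult_left_mono wpt_growth) auto
    finally show ?thesis by (simp add: mult.assoc)
  qed
  have "integrable lborel (\<lambda>v. f (wpt s u x v) * eta_hat \<eta> \<nu> v)" if "u \<in> {0..1}" for u
  proof (rule decays_integrable)
    show "decays 1 (\<lambda>v. f (wpt s u x v) * eta_hat \<eta> \<nu> v)"
      by (rule decays_mult_power[OF \<phi>(1) fb]) (use that in auto)
    show "(\<lambda>v. f (wpt s u x v) * eta_hat \<eta> \<nu> v) \<in> borel_measurable borel"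
      by (intro borel_measurable_continuous_onI continuous_intros fc that \<phi>)
  qed
  then have il: "integrable lborel (\<lambda>v. \<eta> v * g u v)" if "u \<in> {0..1}" for u
    using that by (simp add: g_def eta_hat_def ac_simps)
  then have iP: "integrable P (\<lambda>\<omega>. g u (Y \<omega>))" if "u \<in> {0..1}" for u
    using distributed_integrable[OF Y(1), of "g u"] gm Y(2) that by simp
  have EP: "(\<integral>\<omega>. g u (Y \<omega>) \<partial>P) = (\<integral>v. \<eta> v * g u v \<partial>lborel)" if "u \<in> {0..1}" for u
    using distributed_integral[OF Y(1), of "g u"] gm Y(2) that by simp
  show "integrable P (\<lambda>\<omega>. Y \<omega> ^ (2 * \<nu>) * f (X1 \<sigma> (sqrt t * Y \<omega>) x))"
    using iP[of 1] by (simp add: g_def X1)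
  have Ym [measurable]: "Y \<in> borel_measurable P" using distributed_measurable[OF Y(1)] by simp
  have "(\<integral>\<omega>. g 1 (Y \<omega>) \<partial>P) = (\<integral>v. g 1 v \<partial>distr P borel Y)"
    using gm[of 1] by (simp add: integral_distr)
  also have "\<dots> = (\<integral>v. g 1 v \<partial>distr P borel (\<lambda>\<omega>. - Y \<omega>))"
    using Y(3) by (simp add: symmetric_rv_def)
  also have "\<dots> = (\<integral>\<omega>. g 1 (- Y \<omega>) \<partial>P)"
    using gm[of 1] by (simp add: integral_distr)
  also have "\<dots> = (\<integral>\<omega>. g 0 (Y \<omega>) \<partial>P)" by (simp add: g_def wpt_def)
  finally have sym: "(\<integral>\<omega>. g 1 (Y \<omega>) \<partial>P) = (\<integral>\<omega>. g 0 (Y \<omega>) \<partial>P)" .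
  have "mean_X1 P Y \<sigma> \<nu> t f x = (\<integral>\<omega>. g 1 (Y \<omega>) \<partial>P)"
    by (simp add: mean_X1_def g_def X1)
  also have "\<dots> = ((\<integral>v. \<eta> v * g 0 v \<partial>lborel) + (\<integral>v. \<eta> v * g 1 v \<partial>lborel)) / 2"
    using sym EP[of 0] EP[of 1] by simp
  also have "\<dots> = (\<integral>v. (\<eta> v * g 0 v + \<eta> v * g 1 v) / 2 \<partial>lborel)"
    using il[of 0] il[of 1] by simp
  also have "\<dots> = Gm 0 f (eta_hat \<eta> \<nu>) s x"
    unfolding Gm_def Jm_def by (simp add: g_def eta_hat_def algebra_simps)
  finally show "mean_X1 P Y \<sigma> \<nu> t f x = Gm 0 f (eta_hat \<eta> \<nu>) (\<sigma> * sqrt t / 2) x" by (simp add: s_def)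
qed

text \<open>Passes from the Henstock-Kurzweil integral in \<open>umean\<close> to the Lebesgue
  integral of the representation formula, where the weight in v stands inside as the constant
  \<open>c\<close>.\<close>

lemma Jm_eq_set_integral:
  assumes h: "continuous_on {0..} h" and x: "x \<ge> 0" and m: "m \<ge> 1" and t: "t \<ge> 0"
  shows "(LBINT u:{0..1}. (u - u\<^sup>2) ^ (m - 1) * h (w_arg \<sigma> t u x v) * c) = Jm m h (\<sigma> * sqrt t / 2) x v * c"
proof -
  let ?s = "\<sigma> * sqrt t / 2"
  obtain k where k: "m = Suc k" using m by (cases m) auto
  have w: "w_arg \<sigma> t u x v = wpt ?s u x v" for u
    using t by (simp add: w_arg_def wpt_def power_mult_distrib power_divide)
  have c: "continuous_on {0..1} (\<lambda>u. (u - u\<^sup>2) ^ k * h (wpt ?s u x v) * c)"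
    using x by (intro continuous_intros continuous_on_compose_wpt[OF h]) auto
  have "(LBINT u:{0..1}. (u - u\<^sup>2) ^ k * h (wpt ?s u x v) * c)
      = integral {0..1} (\<lambda>u. (u - u\<^sup>2) ^ k * h (wpt ?s u x v) * c)"
    by (rule set_borel_integral_eq_integral(2)[OF borel_integrable_atLeastAtMost'[OF c]])
  then show ?thesis by (simp add: k w Jm_def)
qed

subsection \<open>Polynomial norms and the main theorem\<close>

lemma pol_normD:
  assumes "pol_norm m L f \<le> ennreal N" "N \<ge> 0" "j \<le> m" "x \<ge> 0"
  shows "\<bar>nderiv {0..} j f x\<bar> \<le> N * (1 + x ^ L)"
proof -
  have "ennreal (\<bar>nderiv {0..} j f x\<bar> / (1 + x ^ L)) \<le> (SUP x\<in>{0..}. ennreal (\<bar>nderiv {0..} j f x\<bar> / (1 + x ^ L)))"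
    using assms by (intro SUP_upper) auto
  also have "\<dots> \<le> pol_norm m L f"
    unfolding pol_norm_def using assms(3) by (intro Max_ge) auto
  also have "\<dots> \<le> ennreal N" by fact
  finally have "\<bar>nderiv {0..} j f x\<bar> / (1 + x ^ L) \<le> N"
    using assms(2) by simp
  moreover have "1 + x ^ L > 0" using assms(4) by (simp add: add_pos_nonneg)
  ultimately show ?thesis by (simp add: field_simps)
qed

lemma pol_norm_leI:
  assumes "\<And>j x. j \<le> m \<Longrightarrow> x \<ge> 0 \<Longrightarrow> \<bar>nderiv {0..} j f x\<bar> \<le> N * (1 + x ^ L)"
  shows "pol_norm m L f \<le> ennreal N"
  unfolding pol_norm_def
proof (rule Max.boundedI)
  fix a assume "a \<in> (\<lambda>j. SUP x\<in>{0..}. ennreal (\<bar>nderiv {0..} j f x\<bar> / (1 + x ^ L))) ` {0..m}"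
  then obtain j where j: "j \<le> m" and a: "a = (SUP x\<in>{0..}. ennreal (\<bar>nderiv {0..} j f x\<bar> / (1 + x ^ L)))"
    by auto
  show "a \<le> ennreal N" unfolding a
  proof (intro SUP_least ennreal_leI)
    fix x :: real assume "x \<in> {0..}"
    then have "x \<ge> 0" by simp
    then have "1 + x ^ L > 0" by (simp add: add_pos_nonneg)
    then show "\<bar>nderiv {0..} j f x\<bar> / (1 + x ^ L) \<le> N"
      using assms[OF j \<open>x \<ge> 0\<close>] by (simp add: field_simps)
  qed
qed auto

lemma pol_norm_mono: "m \<le> M \<Longrightarrow> pol_norm m L f \<le> pol_norm M L f"
  unfolding pol_norm_def by (intro Max_mono image_mono) auto

section \<open>Iteration of the derivative formula for a fixed \<nu>\<close>

locale square_root_scheme =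
  fixes P :: "'a measure" and Y :: "'a \<Rightarrow> real" and \<eta> :: "real \<Rightarrow> real"
    and M L \<nu> :: nat
  assumes dens: "distributed P lborel Y (\<lambda>v. ennreal (\<eta> v))" "\<And>v. \<eta> v \<ge> 0"
    and symm: "symmetric_rv P Y"
    and ed: "euler_decay M (2 * real L + 2) (eta_hat \<eta> \<nu>)"
begin

lemma phi_measurable: "m \<le> M \<Longrightarrow> phi \<eta> \<nu> m \<in> borel_measurable borel"
  by (rule borel_measurable_continuous_onI[OF euler_decay_phi(2)[OF ed]])

context
  fixes f N assumes f: "C_on M f {0..}"
    and growth: "\<And>j y. j \<le> M \<Longrightarrow> y \<ge> 0 \<Longrightarrow> \<bar>nderiv {0..} j f y\<bar> \<le> N * (1 + y ^ L)"
begin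

lemma mean_eq:
  assumes x: "x \<ge> 0"
  shows "integrable P (\<lambda>\<omega>. Y \<omega> ^ (2 * \<nu>) * f (X1 \<sigma> (sqrt t * Y \<omega>) x))"
    and "mean_X1 P Y \<sigma> \<nu> t f x = Gm 0 (nderiv {0..} 0 f) (phi \<eta> \<nu> 0) (\<sigma> * sqrt t / 2) x"
proof -
  have c: "continuous_on {0..} f" "\<And>y. y \<ge> 0 \<Longrightarrow> \<bar>f y\<bar> \<le> N * (1 + y ^ L)"
    using C_on_continuous[OF f, of 0] growth[of 0] by auto
  have p: "decays (2 * real L + 2) (eta_hat \<eta> \<nu>)" "continuous_on UNIV (eta_hat \<eta> \<nu>)"
    using euler_decay_phi[OF ed, of 0] by (auto simp: phi_def)
  note mean_X1_eq_Gm[where \<sigma> = \<sigma> and t = t, OF dens symm c p x]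
  then show "integrable P (\<lambda>\<omega>. Y \<omega> ^ (2 * \<nu>) * f (X1 \<sigma> (sqrt t * Y \<omega>) x))"
    "mean_X1 P Y \<sigma> \<nu> t f x = Gm 0 (nderiv {0..} 0 f) (phi \<eta> \<nu> 0) (\<sigma> * sqrt t / 2) x"
    by (simp_all add: phi_def)
qed

lemma Gm_phi_derivative:
  assumes m: "m < M" and x: "x \<in> {0..}"
  shows "(Gm m (nderiv {0..} m f) (phi \<eta> \<nu> m) s has_real_derivative
    Gm (Suc m) (nderiv {0..} (Suc m) f) (phi \<eta> \<nu> (Suc m)) s x) (at x within {0..})"
proof -
  obtain \<phi>' where \<phi>': "\<And>v. (phi \<eta> \<nu> m has_real_derivative \<phi>' v) (at v)" "continuous_on UNIV \<phi>'"
    "decays (2 * real L + 2) (\<lambda>v. v * \<phi>' v)" "phi \<eta> \<nu> (Suc m) = step_weight m (phi \<eta> \<nu> m) \<phi>'"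
    using euler_decay_phi_step[OF ed m] by blast
  show ?thesis
    unfolding \<phi>'(4)
  proof (rule Gm_derivative[where N = N and L = L])
    show "(nderiv {0..} m f has_real_derivative nderiv {0..} (Suc m) f y) (at y within {0..})" if "y \<ge> 0" for y
      by (rule C_on_has_derivative[OF f m]) (use that in simp)
    show "continuous_on {0..} (nderiv {0..} (Suc m) f)"
      by (rule C_on_continuous[OF f]) (use m in simp)
    show "\<bar>nderiv {0..} m f y\<bar> \<le> N * (1 + y ^ L)" "\<bar>nderiv {0..} (Suc m) f y\<bar> \<le> N * (1 + y ^ L)" if "y \<ge> 0" for y
      using growth[OF _ that] m by (simp_all del: nderiv.simps)
    show "decays (2 * real L + 2) (phi \<eta> \<nu> m)"
      by (rule euler_decay_phi[OF ed]) (use m in simp)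
  qed (use \<phi>' x in auto)
qed

lemma mean_nderiv:
  assumes "m \<le> M" "x \<ge> 0"
  shows "nderiv {0..} m (mean_X1 P Y \<sigma> \<nu> t f) x = Gm m (nderiv {0..} m f) (phi \<eta> \<nu> m) (\<sigma> * sqrt t / 2) x"
  by (rule nderiv_eqI[where m = M and g = "\<lambda>m. Gm m (nderiv {0..} m f) (phi \<eta> \<nu> m) (\<sigma> * sqrt t / 2)"])
    (use assms mean_eq Gm_phi_derivative at_within_atLeast_neq_bot in auto)

lemma mean_ntimes_differentiable:
  assumes "m \<le> M"
  shows "ntimes_differentiable_on m (mean_X1 P Y \<sigma> \<nu> t f) {0..}"
  by (rule ntimes_differentiable_onI[where g = "\<lambda>m. Gm m (nderiv {0..} m f) (phi \<eta> \<nu> m) (\<sigma> * sqrt t / 2)"])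
    (use assms mean_eq Gm_phi_derivative at_within_atLeast_neq_bot in auto)

lemma mean_C_on:
  assumes "m \<le> M"
  shows "C_on m (mean_X1 P Y \<sigma> \<nu> t f) {0..}"
proof -
  have "continuous_on {0..} (Gm m (nderiv {0..} m f) (phi \<eta> \<nu> m) (\<sigma> * sqrt t / 2))"
    using assms
    by (intro Gm_continuous[where N = N and L = L] C_on_continuous[OF f] growth euler_decay_phi[OF ed] phi_measurable)
  then have "continuous_on {0..} (nderiv {0..} m (mean_X1 P Y \<sigma> \<nu> t f))"
    by (rule continuous_on_eq) (use mean_nderiv[OF assms] in simp)
  then show ?thesis using mean_ntimes_differentiable[OF assms] by (simp add: C_on_def)
qed

lemma representation:
  assumes m: "1 \<le> m" "m \<le> M" and x: "x \<ge> 0" and t: "t \<ge> 0"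
  shows "integrable lborel (\<lambda>v. LBINT u:{0..1}.
      (u - u\<^sup>2) ^ (m - 1) * nderiv {0..} m f (w_arg \<sigma> t u x v) * eta_star \<eta> \<nu> m v)" (is ?int)
    and "nderiv {0..} m (mean_X1 P Y \<sigma> \<nu> t f) x =
      (LBINT v. LBINT u:{0..1}. (u - u\<^sup>2) ^ (m - 1) * nderiv {0..} m f (w_arg \<sigma> t u x v) * eta_star \<eta> \<nu> m v)" (is ?eq)
proof -
  have c: "continuous_on {0..} (nderiv {0..} m f)" by (rule C_on_continuous[OF f m(2)])
  note J = Jm_eq_set_integral[OF c x m(1) t]
  have star: "eta_star \<eta> \<nu> m = phi \<eta> \<nu> m" using m by (simp add: phi_def)
  show ?int
    unfolding J star
    by (rule Jm_integrable[OF c growth[OF m(2)] x euler_decay_phi(1)[OF ed m(2)] phi_measurable[OF m(2)]])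
  show ?eq
    unfolding J mean_nderiv[OF m(2) x] star Gm_def ..
qed

text \<open>The constant \<open>N'\<close> concerns the order m alone, while \<open>N\<close> covers
  all orders up to M and only secures integrability and differentiability. The final estimate can
  therefore use the norm of order m.\<close>

lemma mean_nderiv_bound:
  assumes m: "m \<le> M" and x: "x \<ge> 0" and s: "\<bar>\<sigma> * sqrt t / 2\<bar> \<le> S"
    and growth': "\<And>y. y \<ge> 0 \<Longrightarrow> \<bar>nderiv {0..} m f y\<bar> \<le> N' * (1 + y ^ L)"
  shows "\<bar>nderiv {0..} m (mean_X1 P Y \<sigma> \<nu> t f) x\<bar> \<le> N' * (1 + x ^ L) *
     (umean m (\<lambda>u. 1) * (\<integral>v. \<bar>phi \<eta> \<nu> m v\<bar> \<partial>lborel)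
    + (\<sigma> * sqrt t / 2)\<^sup>2 * (growth_const S L * umean m (\<lambda>u. 1) * (\<integral>v. (1 + \<bar>v\<bar>) ^ (2 * L) * \<bar>phi \<eta> \<nu> m v\<bar> \<partial>lborel)))"
  unfolding mean_nderiv[OF m x]
  by (intro Gm_bound C_on_continuous[OF f] growth' euler_decay_phi[OF ed] m x s)

end

text \<open>Each step preserves the product of the two masses, and at index 0 the average of 1 is
  1.\<close>

lemma umean_integral_phi:
  assumes "m \<le> M"
  shows "umean m (\<lambda>u. 1) * (\<integral>v. phi \<eta> \<nu> m v \<partial>lborel) = (\<integral>v. eta_hat \<eta> \<nu> v \<partial>lborel)"
  using assms
proof (induction m)
  case (Suc m)
  obtain \<phi>' where \<phi>': "\<And>v. (phi \<eta> \<nu> m has_real_derivative \<phi>' v) (at v)" "continuous_on UNIV \<phi>'"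
    "decays (2 * real L + 2) (\<lambda>v. v * \<phi>' v)" "phi \<eta> \<nu> (Suc m) = step_weight m (phi \<eta> \<nu> m) \<phi>'"
    using euler_decay_phi_step[OF ed, of m] Suc.prems by (metis Suc_le_eq)
  have "decays 1 (phi \<eta> \<nu> m)" "decays 1 (\<lambda>v. v * \<phi>' v)"
    using euler_decay_phi(1)[OF ed, of m] \<phi>'(3) Suc.prems by (auto intro: decays_weaken)
  from umean_integral_step_weight[OF \<phi>'(1,2) this, of m] Suc show ?case
    by (simp only: \<phi>'(4))
qed (simp add: phi_def)

end

section \<open>Consequences of the hypotheses on the density\<close>

lemma prob_density_integral:
  assumes "prob_space P" "distributed P lborel Y (\<lambda>v. ennreal (\<eta> v))" "\<And>v. \<eta> v \<ge> 0"
  shows "(\<integral>v. \<eta> v \<partial>lborel) = (1::real)"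
proof -
  interpret prob_space P by fact
  show ?thesis
    using distributed_integral[OF assms(2), of "\<lambda>_. 1"] assms(3) by (simp add: prob_space)
qed

text \<open>Multiplication by v^(2\<nu>) costs 2\<nu> \<le> 2\<Xi> orders of 2 (L + \<Xi> + 1),
  which leaves at least 2L + 2.\<close>

lemma euler_decay_eta_hat:
  assumes \<eta>: "C_on M \<eta> UNIV"
    and o: "\<And>i. i \<le> M \<Longrightarrow> \<exists>\<epsilon>>0. (\<lambda>v. \<bar>nderiv UNIV i \<eta> v\<bar>)
        \<in> o[at_infinity](\<lambda>v. \<bar>v\<bar> powr (- 2 * (real L + real \<Xi> + 1 + \<epsilon>) - real i))"
    and \<nu>: "\<nu> \<le> \<Xi>"
  shows "euler_decay M (2 * real L + 2) (eta_hat \<eta> \<nu>)"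
proof -
  have "euler_decay M (2 * (real L + real \<Xi> + 1)) \<eta>"
    unfolding euler_decay_def
  proof (intro conjI allI impI \<eta>)
    fix j assume j: "j \<le> M"
    obtain \<epsilon> where "\<epsilon> > 0" "(\<lambda>v. \<bar>nderiv UNIV j \<eta> v\<bar>)
        \<in> o[at_infinity](\<lambda>v. \<bar>v\<bar> powr (- 2 * (real L + real \<Xi> + 1 + \<epsilon>) - real j))"
      using o[OF j] by blast
    then show "decays (2 * (real L + real \<Xi> + 1)) (\<lambda>v. v ^ j * nderiv UNIV j \<eta> v)"
      by (intro decays_of_smallo C_on_continuous[OF \<eta> j])
  qed
  from euler_decay_mult_power[OF this, of "2 * \<nu>"] \<nu> show ?thesis
    by (auto simp: euler_decay_def eta_hat_def[abs_def] intro: decays_weaken)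
qed

theorem lemmaB1p1:
  fixes P :: "'a measure" and Y :: "'a \<Rightarrow> real" and \<eta> :: "real \<Rightarrow> real"
    and \<sigma> T :: real and M L \<Xi> :: nat
  assumes "\<sigma> > 0" and "T > 0"
    and "prob_space P"
    and "distributed P lborel Y (\<lambda>v. ennreal (\<eta> v))" and "\<And>v. \<eta> v \<ge> 0"
    and "symmetric_rv P Y"
    and "C_on M \<eta> UNIV"
    and "\<And>i. i \<in> {0..M} \<Longrightarrow> \<exists>\<epsilon>>0.
      (\<lambda>v. \<bar>nderiv UNIV i \<eta> v\<bar>)
        \<in> o[at_infinity](\<lambda>v. \<bar>v\<bar> powr (- 2 * (real L + real \<Xi> + 1 + \<epsilon>) - real i))"
  shows "(\<forall>f\<in>C_pol M L. \<forall>m\<in>{1..M}. \<forall>\<nu>\<in>{0..\<Xi>}. \<forall>t\<in>{0..T}.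
        (\<forall>x\<ge>0. integrable P (\<lambda>\<omega>. Y \<omega> ^ (2 * \<nu>) * f (X1 \<sigma> (sqrt t * Y \<omega>) x)))
      \<and> ntimes_differentiable_on m (mean_X1 P Y \<sigma> \<nu> t f) {0..}
      \<and> (\<forall>x\<ge>0.
          integrable lborel (\<lambda>v. LBINT u:{0..1}.
            (u - u\<^sup>2) ^ (m - 1) * nderiv {0..} m f (w_arg \<sigma> t u x v) * eta_star \<eta> \<nu> m v)
        \<and> nderiv {0..} m (mean_X1 P Y \<sigma> \<nu> t f) x =
          (LBINT v. LBINT u:{0..1}.
            (u - u\<^sup>2) ^ (m - 1) * nderiv {0..} m f (w_arg \<sigma> t u x v) * eta_star \<eta> \<nu> m v)))
    \<and> ((\<forall>m\<in>{1..M}. \<forall>v. eta_star \<eta> 0 m v \<ge> 0) \<longrightarrow>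
        (\<exists>C\<ge>0. \<forall>f\<in>C_pol M L. \<forall>m\<in>{1..M}. \<forall>t\<in>{0..T}.
          mean_X1 P Y \<sigma> 0 t f \<in> C_pol m L
        \<and> pol_norm m L (mean_X1 P Y \<sigma> 0 t f) \<le> ennreal (1 + C * t) * pol_norm m L f)
      \<and> (\<forall>\<nu>\<in>{1..\<Xi>}. \<exists>C\<ge>0. \<forall>f\<in>C_pol M L. \<forall>m\<in>{1..M}. \<forall>t\<in>{0..T}.
          mean_X1 P Y \<sigma> \<nu> t f \<in> C_pol m L
        \<and> pol_norm m L (mean_X1 P Y \<sigma> \<nu> t f) \<le> ennreal C * pol_norm m L f))"
proof -
  have sch: "square_root_scheme P Y \<eta> M L \<nu>" if "\<nu> \<le> \<Xi>" for \<nu>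
    by (intro square_root_scheme.intro assms(4-6) euler_decay_eta_hat[OF assms(7) _ that] assms(8)) simp
  have C_polD: "C_on M f {0..}"
    "\<exists>N\<ge>0. pol_norm m L f = ennreal N \<and> (\<forall>j\<le>m. \<forall>y\<ge>0. \<bar>nderiv {0..} j f y\<bar> \<le> N * (1 + y ^ L))"
    if "f \<in> C_pol M L" "m \<le> M" for f m
  proof -
    show "C_on M f {0..}" using that by (simp add: C_pol_def)
    have "pol_norm m L f < \<infinity>"
      using that pol_norm_mono[of m M L f] by (auto simp: C_pol_def)
    then obtain N where "N \<ge> 0" "pol_norm m L f = ennreal N"
      by (cases "pol_norm m L f") auto
    then show "\<exists>N\<ge>0. pol_norm m L f = ennreal N \<and> (\<forall>j\<le>m. \<forall>y\<ge>0. \<bar>nderiv {0..} j f y\<bar> \<le> N * (1 + y ^ L))"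
      using pol_normD[of m L f N] by auto
  qed
  define S where "S = \<sigma> * sqrt T / 2"
  have S: "S \<ge> 0" using assms(1,2) by (simp add: S_def)
  have s_le: "\<bar>\<sigma> * sqrt t / 2\<bar> \<le> S" if "t \<in> {0..T}" for t
    using that assms(1) by (simp add: S_def abs_mult)
  \<comment> \<open>In the bound \<open>mean_nderiv_bound\<close>, \<open>B\<close> is the leading
    constant and \<open>K\<close> the coefficient of s^2.\<close>
  define B where "B = (\<lambda>\<nu> m. umean m (\<lambda>u. 1) * (\<integral>v. \<bar>phi \<eta> \<nu> m v\<bar> \<partial>lborel))"
  define K where "K = (\<lambda>\<nu> m. growth_const S L * umean m (\<lambda>u. 1) * (\<integral>v. (1 + \<bar>v\<bar>) ^ (2 * L) * \<bar>phi \<eta> \<nu> m v\<bar> \<partial>lborel))"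
  have B0: "B \<nu> m \<ge> 0" for \<nu> m
    unfolding B_def by (intro mult_nonneg_nonneg umean_one_nonneg integral_nonneg_AE) auto
  have K0: "K \<nu> m \<ge> 0" for \<nu> m
    unfolding K_def growth_const_def using S
    by (intro mult_nonneg_nonneg umean_one_nonneg integral_nonneg_AE) auto
  have bounded: "mean_X1 P Y \<sigma> \<nu> t f \<in> C_pol m L
      \<and> pol_norm m L (mean_X1 P Y \<sigma> \<nu> t f) \<le> ennreal c * pol_norm m L f"
    if f: "f \<in> C_pol M L" and m: "m \<le> M" and \<nu>: "\<nu> \<le> \<Xi>" and t: "t \<in> {0..T}" and c: "c \<ge> 0"
      and le: "\<And>j. j \<le> m \<Longrightarrow> B \<nu> j + (\<sigma> * sqrt t / 2)\<^sup>2 * K \<nu> j \<le> c" for f m \<nu> t c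
  proof -
    interpret square_root_scheme P Y \<eta> M L \<nu> by (rule sch[OF \<nu>])
    \<comment> \<open>\<open>N0\<close> bounds all derivatives up to order M for the qualitative
      statements; \<open>N\<close>, the norm of order m, enters the estimate.\<close>
    obtain N0 where N0: "\<And>j y. j \<le> M \<Longrightarrow> y \<ge> 0 \<Longrightarrow> \<bar>nderiv {0..} j f y\<bar> \<le> N0 * (1 + y ^ L)"
      using C_polD(2)[OF f order_refl] by blast
    obtain N where N: "N \<ge> 0" "pol_norm m L f = ennreal N"
      "\<And>j y. j \<le> m \<Longrightarrow> y \<ge> 0 \<Longrightarrow> \<bar>nderiv {0..} j f y\<bar> \<le> N * (1 + y ^ L)"
      using C_polD(2)[OF f m] by blast
    note fC = C_polD(1)[OF f m]
    have "pol_norm m L (mean_X1 P Y \<sigma> \<nu> t f) \<le> ennreal (c * N)"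
    proof (rule pol_norm_leI)
      fix j and x :: real assume j: "j \<le> m" and x: "x \<ge> 0"
      have "\<bar>nderiv {0..} j (mean_X1 P Y \<sigma> \<nu> t f) x\<bar> \<le> N * (1 + x ^ L) * (B \<nu> j + (\<sigma> * sqrt t / 2)\<^sup>2 * K \<nu> j)"
        unfolding B_def K_def
        by (rule mean_nderiv_bound[OF fC N0 _ x s_le[OF t] N(3)[OF j]]) (use j m in auto)
      also have "\<dots> \<le> N * (1 + x ^ L) * c"
        using N(1) x by (intro mult_left_mono le j) auto
      finally show "\<bar>nderiv {0..} j (mean_X1 P Y \<sigma> \<nu> t f) x\<bar> \<le> c * N * (1 + x ^ L)"
        by (simp add: ac_simps)
    qed
    then have le': "pol_norm m L (mean_X1 P Y \<sigma> \<nu> t f) \<le> ennreal c * pol_norm m L f"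
      using N c by (simp add: ennreal_mult)
    have "ennreal c * pol_norm m L f < \<infinity>"
      using N by (simp add: ennreal_mult_less_top)
    then show ?thesis
      using le' mean_C_on[OF fC N0 m] by (auto simp: C_pol_def)
  qed
  have part1: "(\<forall>x\<ge>0. integrable P (\<lambda>\<omega>. Y \<omega> ^ (2 * \<nu>) * f (X1 \<sigma> (sqrt t * Y \<omega>) x)))
      \<and> ntimes_differentiable_on m (mean_X1 P Y \<sigma> \<nu> t f) {0..}
      \<and> (\<forall>x\<ge>0.
          integrable lborel (\<lambda>v. LBINT u:{0..1}.
            (u - u\<^sup>2) ^ (m - 1) * nderiv {0..} m f (w_arg \<sigma> t u x v) * eta_star \<eta> \<nu> m v)
        \<and> nderiv {0..} m (mean_X1 P Y \<sigma> \<nu> t f) x =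
          (LBINT v. LBINT u:{0..1}.
            (u - u\<^sup>2) ^ (m - 1) * nderiv {0..} m f (w_arg \<sigma> t u x v) * eta_star \<eta> \<nu> m v))"
    if f: "f \<in> C_pol M L" and m: "m \<in> {1..M}" and \<nu>: "\<nu> \<in> {0..\<Xi>}" and t: "t \<in> {0..T}" for f m \<nu> t
  proof -
    interpret square_root_scheme P Y \<eta> M L \<nu> by (rule sch) (use \<nu> in simp)
    obtain N0 where N0: "\<And>j y. j \<le> M \<Longrightarrow> y \<ge> 0 \<Longrightarrow> \<bar>nderiv {0..} j f y\<bar> \<le> N0 * (1 + y ^ L)"
      using C_polD(2)[OF f order_refl] by blast
    have m': "1 \<le> m" "m \<le> M" and t': "t \<ge> 0" using m t by auto
    note fC = C_polD(1)[OF f m'(2)]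
    show ?thesis
      by (intro conjI allI impI mean_eq(1)[OF fC N0] mean_ntimes_differentiable[OF fC N0 m'(2)]
          representation[OF fC N0 m' _ t'])
  qed
  have part2: "\<exists>C\<ge>0. \<forall>f\<in>C_pol M L. \<forall>m\<in>{1..M}. \<forall>t\<in>{0..T}.
          mean_X1 P Y \<sigma> 0 t f \<in> C_pol m L
        \<and> pol_norm m L (mean_X1 P Y \<sigma> 0 t f) \<le> ennreal (1 + C * t) * pol_norm m L f"
    if nn: "\<forall>m\<in>{1..M}. \<forall>v. eta_star \<eta> 0 m v \<ge> 0"
  proof -
    interpret square_root_scheme P Y \<eta> M L 0 by (rule sch) simp
    \<comment> \<open>Nonnegativity removes the absolute value, so the leading constant is the
      preserved mass, the integral of the density.\<close>
    have B1: "B 0 j = 1" if "j \<le> M" for j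
    proof -
      have "phi \<eta> 0 j v \<ge> 0" for v
        using nn assms(5) that by (auto simp: phi_def eta_hat_def)
      then have "B 0 j = umean j (\<lambda>u. 1) * (\<integral>v. phi \<eta> 0 j v \<partial>lborel)"
        by (simp add: B_def del: umean.simps)
      also have "\<dots> = 1"
        unfolding umean_integral_phi[OF that]
        using prob_density_integral[OF assms(3-5)] by (simp add: eta_hat_def[abs_def])
      finally show ?thesis .
    qed
    \<comment> \<open>Here s^2 = \<sigma>^2 t / 4; the sum over j majorises every single K.\<close>
    define C where "C = \<sigma>\<^sup>2 / 4 * (\<Sum>j\<le>M. K 0 j)"
    have C: "C \<ge> 0" unfolding C_def by (intro mult_nonneg_nonneg sum_nonneg K0) auto
    have "B 0 j + (\<sigma> * sqrt t / 2)\<^sup>2 * K 0 j \<le> 1 + C * t" if "j \<le> M" "t \<ge> 0" for j t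
    proof -
      have "K 0 j \<le> (\<Sum>j\<le>M. K 0 j)" using that K0 by (intro member_le_sum) auto
      then have "\<sigma>\<^sup>2 / 4 * t * K 0 j \<le> \<sigma>\<^sup>2 / 4 * t * (\<Sum>j\<le>M. K 0 j)"
        using that by (intro mult_left_mono) auto
      then show ?thesis using that
        by (simp add: B1 C_def power_mult_distrib power_divide ac_simps)
    qed
    then show ?thesis
      using C by (intro exI[of _ C] conjI ballI bounded) auto
  qed
  have part3: "\<exists>C\<ge>0. \<forall>f\<in>C_pol M L. \<forall>m\<in>{1..M}. \<forall>t\<in>{0..T}.
          mean_X1 P Y \<sigma> \<nu> t f \<in> C_pol m L
        \<and> pol_norm m L (mean_X1 P Y \<sigma> \<nu> t f) \<le> ennreal C * pol_norm m L f"
    if \<nu>: "\<nu> \<in> {1..\<Xi>}" for \<nu>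
  proof -
    \<comment> \<open>For \<nu> \<ge> 1 no sharp leading constant is claimed, so s^2 is simply
      replaced by its maximum S^2 over [0, T].\<close>
    define C where "C = (\<Sum>j\<le>M. B \<nu> j + S\<^sup>2 * K \<nu> j)"
    have C: "C \<ge> 0" unfolding C_def by (intro sum_nonneg add_nonneg_nonneg mult_nonneg_nonneg B0 K0) auto
    have "B \<nu> j + (\<sigma> * sqrt t / 2)\<^sup>2 * K \<nu> j \<le> C" if "j \<le> M" "t \<in> {0..T}" for j t
    proof -
      have "(\<sigma> * sqrt t / 2)\<^sup>2 \<le> S\<^sup>2" using s_le[OF that(2)] by (rule power2_le_iff_abs_le[OF S, THEN iffD2])
      then have "B \<nu> j + (\<sigma> * sqrt t / 2)\<^sup>2 * K \<nu> j \<le> B \<nu> j + S\<^sup>2 * K \<nu> j"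
        by (intro add_left_mono mult_right_mono K0)
      also have "\<dots> \<le> C"
        unfolding C_def using that B0 K0 by (intro member_le_sum) auto
      finally show ?thesis .
    qed
    then show ?thesis
      using C \<nu> by (intro exI[of _ C] conjI ballI bounded) auto
  qed
  show ?thesis
    apply (rule conjI)
     apply (intro ballI, rule part1; assumption)
    apply (rule impI, rule conjI, rule part2, assumption)
    apply (rule ballI, rule part3, assumption)
    done
qed

end
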